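(* For all $1\le i,j,k,l\le\nu$ and $a,b\in\mathbb{C}^{\times}$, the following identity of formal series of operators on $M$ holds: $$\begin{aligned} [X_{ij}(a,z),X_{kl}(b,w)] =\;&2\delta_{jk}\Big(X_{il}(ab,z)+\delta_{il}(1-\delta_{ab,1})\tfrac{1+ab}{1-ab}\Big)\delta\Big(\frac{w}{az}\Big)\\ &-2\delta_{il}\Big(X_{kj}(ab,b^{-1}z)+\delta_{jk}(1-\delta_{ab,1})\tfrac{1+ab}{1-ab}\Big)\delta\Big(\frac{bw}{z}\Big)\\ &+2\delta_{ik}\Big(X_{lj}(ab^{-1},bz)+\delta_{jl}(1-\delta_{a,b})\tfrac{1+ab^{-1}}{1-ab^{-1}}\Big)\delta\Big(-\frac{w}{z}\Big)\\ &-2\delta_{jl}\Big(X_{ik}(ab^{-1},z)+\delta_{ik}(1-\delta_{a,b})\tfrac{1+ab^{-1}}{1-ab^{-1}}\Big)\delta\Big(-\frac{bw}{az}\Big)\\ &+4\delta_{il}\delta_{jk}\delta_{ab,1}(D\delta)\Big(\frac{w}{az}\Big)-4\delta_{ik}\delta_{jl}\delta_{a,b}(D\delta)\Big(-\frac{w}{z}\Big), \end{aligned}$$ where a term $(1-\delta_{ab,1})\frac{1+ab}{1-ab}$ is read as $0$ if $ab=1$, and $(1-\delta_{a,b})\frac{1+ab^{-1}}{1-ab^{-1}}$ is read as $0$ if $a=b$.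
   Context: Fix an integer $\nu\ge2$; $\mathbb N=\{0,1,2,\dots\}$. Let $\Gamma=\bigoplus_{i=1}^{\nu}\mathbb{Z}\epsilon_i$ with $(\epsilon_i,\epsilon_j)=\delta_{ij}$. Let $\mathcal H$ be the complex Lie algebra spanned by $\epsilon_i(n)$ ($1\le i\le\nu$, $n\in2\mathbb Z+1$) and a central element $1$, with $[\alpha(m),\beta(n)]=\frac m2(\alpha,\beta)\delta_{m+n,0}\,1$, where $\alpha(n)=\sum_i c_i\epsilon_i(n)$ for $\alpha=\sum_i c_i\epsilon_i\in\Gamma$. Let $\varepsilon:\Gamma\times\Gamma\to\{\pm1\}$ be bimultiplicative with $\varepsilon(\epsilon_i,\epsilon_j)=1$ if $i\le j$ and $-1$ if $i>j$. Let $\bar\Gamma=\Gamma/2\Gamma$ and let $\mathbb C[\bar\Gamma]$ be the twisted group algebra with basis $e^{\bar\alpha}$ ($\bar\alpha\in\bar\Gamma$) and product $e^{\bar\alpha}e^{\bar\beta}=\varepsilon(\alpha,\beta)e^{\overline{\alpha+\beta}}$. Let $\mathcal H^-$ be the span of $\epsilon_i(n)$, $n\in-(2\mathbb N+1)$, and $M=\mathbb C[\bar\Gamma]\otimes\mathcal S(\mathcal H^-)$ the Fock space: $e^{\bar\alpha}$ acts by left multiplication on the first factor; on the symmetric algebra $\mathcal S(\mathcal H^-)$, $\epsilon_i(n)$ acts by multiplication if $n<0$ and, if $n>0$, as the derivation with $\epsilon_i(n)\cdot\epsilon_j(m)=\frac n2\delta_{ij}\delta_{m+n,0}$; $1$ acts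 as identity. Put $E_{\pm}(\alpha,z)=\exp\big(-2\sum_{n\in\pm(2\mathbb N+1)}\frac{\alpha(n)}{n}z^{-n}\big)$, $\epsilon_i(z)=\sum_{n\in2\mathbb Z+1}\epsilon_i(n)z^{-n}$. For $a\in\mathbb C^\times$ define $X_{ij}(a,z)=\varepsilon(\epsilon_i,\epsilon_j)e^{\overline{\epsilon_i-\epsilon_j}}E_-(\epsilon_i,z)E_-(-\epsilon_j,az)E_+(\epsilon_i,z)E_+(-\epsilon_j,az)$ if $i\ne j$; $X_{ii}(1,z)=4\epsilon_i(z)$; and $X_{ii}(a,z)=\frac{1+a}{1-a}\big(E_-(\epsilon_i,z)E_-(-\epsilon_i,az)E_+(\epsilon_i,z)E_+(-\epsilon_i,az)-1\big)$ if $a\ne1$. Formal delta functions: $\delta(z)=\sum_{n\in\mathbb Z}z^n$, $(D\delta)(z)=\sum_{n\in\mathbb Z}nz^n$. *)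

theory Defs
  imports
    Complex_Main
    "HOL-Library.Poly_Mapping"
    "HOL-Library.Groups_Big_Fun"
    "HOL-Library.Function_Algebras"
begin

text \<open>
  The rank \<open>\<nu>\<close> is the cardinality of a finite, linearly ordered index type \<open>'n\<close>, which plays the
  role of \<open>{1, ..., \<nu>}\<close>.
\<close>

section \<open>The lattice, the cocycle and the quotient modulo 2\<close>

type_synonym 'n lattice = "'n \<Rightarrow>\<^sub>0 int"

definition eps_vec :: "'n \<Rightarrow> 'n lattice" where
  "eps_vec i = Poly_Mapping.single i 1"

definition lattice_form :: "'n::finite lattice \<Rightarrow> 'n lattice \<Rightarrow> int" where
  "lattice_form \<alpha> \<beta> = (\<Sum>i\<in>UNIV. poly_mapping.lookup \<alpha> i * poly_mapping.lookup \<beta> i)"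

definition cocycle :: "'n::{finite,linorder} lattice \<Rightarrow> 'n lattice \<Rightarrow> complex" where
  "cocycle \<alpha> \<beta> = (\<Prod>i\<in>UNIV. \<Prod>j\<in>UNIV.
     (if i \<le> j then 1 else - 1) powi (poly_mapping.lookup \<alpha> i * poly_mapping.lookup \<beta> j))"

lemma cocycle_add_left: "cocycle (\<alpha> + \<alpha>') \<beta> = cocycle \<alpha> \<beta> * cocycle \<alpha>' \<beta>"
  unfolding cocycle_def prod.distrib[symmetric]
  by (intro prod.cong refl) (simp add: lookup_add distrib_right power_int_add)

lemma cocycle_add_right: "cocycle \<alpha> (\<beta> + \<beta>') = cocycle \<alpha> \<beta> * cocycle \<alpha> \<beta>'"
  unfolding cocycle_def prod.distrib[symmetric]
  by (intro prod.cong refl) (simp add: lookup_add distrib_left power_int_add)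

lemma cocycle_eps_vec:
  "cocycle (eps_vec i) (eps_vec j) = (if i \<le> j then 1 else - 1)"
proof -
  have "cocycle (eps_vec i) (eps_vec j) =
      (\<Prod>k\<in>UNIV. \<Prod>l\<in>UNIV. if l = j then (if k = i then (if i \<le> j then 1 else - 1) else 1) else 1)"
    unfolding cocycle_def eps_vec_def
    by (intro prod.cong refl) (auto simp: lookup_single when_def)
  also have "\<dots> = (if i \<le> j then 1 else - 1)"
    by (simp add: prod.delta)
  finally show ?thesis .
qed

lemma cocycle_square: "cocycle \<alpha> \<beta> * cocycle \<alpha> \<beta> = 1"
  unfolding cocycle_def prod.distrib[symmetric]
  by (intro prod.neutral ballI) (simp flip: power_int_mult_distrib)

quotient_type 'n lattice_mod2 = "'n lattice" / "\<lambda>\<alpha> \<beta>. \<exists>\<gamma>. \<alpha> - \<beta> = \<gamma> + \<gamma>"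
  morphisms rep_mod2 mod2
proof (rule equivpI)
  show "reflp (\<lambda>\<alpha> \<beta> :: 'n lattice. \<exists>\<gamma>. \<alpha> - \<beta> = \<gamma> + \<gamma>)"
    by (intro reflpI exI[of _ 0]) simp
  show "symp (\<lambda>\<alpha> \<beta> :: 'n lattice. \<exists>\<gamma>. \<alpha> - \<beta> = \<gamma> + \<gamma>)"
  proof (intro sympI, elim exE)
    fix \<alpha> \<beta> \<gamma> :: "'n lattice"
    assume "\<alpha> - \<beta> = \<gamma> + \<gamma>"
    then have "\<beta> - \<alpha> = (- \<gamma>) + (- \<gamma>)"
      by (simp add: algebra_simps)
    then show "\<exists>\<gamma>. \<beta> - \<alpha> = \<gamma> + \<gamma>" ..
  qed
  show "transp (\<lambda>\<alpha> \<beta> :: 'n lattice. \<exists>\<gamma>. \<alpha> - \<beta> = \<gamma> + \<gamma>)"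
  proof (intro transpI, elim exE)
    fix \<alpha> \<beta> \<delta> \<gamma> \<gamma>' :: "'n lattice"
    assume "\<alpha> - \<beta> = \<gamma> + \<gamma>" "\<beta> - \<delta> = \<gamma>' + \<gamma>'"
    then have "\<alpha> - \<delta> = (\<gamma> + \<gamma>') + (\<gamma> + \<gamma>')"
      by (simp add: algebra_simps)
    then show "\<exists>\<gamma>. \<alpha> - \<delta> = \<gamma> + \<gamma>" ..
  qed
qed

instantiation lattice_mod2 :: (type) ab_group_add
begin

lift_definition zero_lattice_mod2 :: "'a lattice_mod2" is 0 .

lift_definition plus_lattice_mod2 :: "'a lattice_mod2 \<Rightarrow> 'a lattice_mod2 \<Rightarrow> 'a lattice_mod2"
  is "(+)"
proof (elim exE)
  fix \<alpha> \<alpha>' \<beta> \<beta>' \<gamma> \<delta> :: "'a lattice"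
  assume "\<alpha> - \<alpha>' = \<gamma> + \<gamma>" "\<beta> - \<beta>' = \<delta> + \<delta>"
  then have "(\<alpha> + \<beta>) - (\<alpha>' + \<beta>') = (\<gamma> + \<delta>) + (\<gamma> + \<delta>)"
    by (simp add: algebra_simps)
  then show "\<exists>\<gamma>. (\<alpha> + \<beta>) - (\<alpha>' + \<beta>') = \<gamma> + \<gamma>" ..
qed

lift_definition uminus_lattice_mod2 :: "'a lattice_mod2 \<Rightarrow> 'a lattice_mod2" is uminus
proof (elim exE)
  fix \<alpha> \<beta> \<gamma> :: "'a lattice"
  assume "\<alpha> - \<beta> = \<gamma> + \<gamma>"
  then have "(- \<alpha>) - (- \<beta>) = (- \<gamma>) + (- \<gamma>)"
    by (simp add: algebra_simps)
  then show "\<exists>\<gamma>. (- \<alpha>) - (- \<beta>) = \<gamma> + \<gamma>" ..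
qed

definition minus_lattice_mod2 :: "'a lattice_mod2 \<Rightarrow> 'a lattice_mod2 \<Rightarrow> 'a lattice_mod2" where
  "minus_lattice_mod2 x y = x + (- y)"

instance
proof
  fix x y z :: "'a lattice_mod2"
  show "x + y + z = x + (y + z)"
    by transfer (rule exI[of _ 0], simp add: algebra_simps)
  show "x + y = y + x"
    by transfer (rule exI[of _ 0], simp add: algebra_simps)
  show "0 + x = x"
    by transfer (rule exI[of _ 0], simp)
  show "- x + x = 0"
    by transfer (rule exI[of _ 0], simp)
  show "x - y = x + (- y)"
    by (rule minus_lattice_mod2_def)
qed

end

lift_definition cocycle_mod2 ::
  "'n::{finite,linorder} lattice_mod2 \<Rightarrow> 'n lattice_mod2 \<Rightarrow> complex" is cocycle
proof (elim exE)
  fix \<alpha> \<alpha>' \<beta> \<beta>' \<gamma> \<delta> :: "'n lattice"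
  assume "\<alpha> - \<alpha>' = \<gamma> + \<gamma>" "\<beta> - \<beta>' = \<delta> + \<delta>"
  then have "\<alpha> = \<alpha>' + (\<gamma> + \<gamma>)" "\<beta> = \<beta>' + (\<delta> + \<delta>)"
    by (metis add.commute diff_add_cancel)+
  then show "cocycle \<alpha> \<beta> = cocycle \<alpha>' \<beta>'"
    by (simp add: cocycle_add_left cocycle_add_right cocycle_square)
qed


section \<open>The Fock space\<close>

text \<open>
  \<open>\<S>(\<H>\<^sup>-)\<close> is the polynomial algebra on the basis of \<open>\<H>\<^sup>-\<close>; the variable \<open>(i, r)\<close> stands for
  \<open>\<epsilon>\<^sub>i(-(2r+1))\<close>. An element of \<open>\<complex>[\<Gamma>/2\<Gamma>] \<otimes> \<S>(\<H>\<^sup>-)\<close> is given by its \<open>\<S>(\<H>\<^sup>-)\<close>-coefficients with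
  respect to the basis \<open>e\<^sup>\<beta>\<close> of the first factor, so that \<open>e\<^sup>\<beta> \<otimes> f\<close> is
  \<open>Poly_Mapping.single \<beta> f\<close>.
\<close>

type_synonym 'n sym = "(('n \<times> nat) \<Rightarrow>\<^sub>0 nat) \<Rightarrow>\<^sub>0 complex"
type_synonym 'n fock = "'n lattice_mod2 \<Rightarrow>\<^sub>0 'n sym"

definition sym_const :: "complex \<Rightarrow> 'n sym" where
  "sym_const c = Poly_Mapping.single 0 c"

definition sym_var :: "'n \<times> nat \<Rightarrow> 'n sym" where
  "sym_var x = Poly_Mapping.single (Poly_Mapping.single x 1) 1"

definition sym_pderiv :: "'n \<times> nat \<Rightarrow> 'n sym \<Rightarrow> 'n sym" where
  "sym_pderiv x p = (\<Sum>m\<in>Poly_Mapping.keys p.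
     Poly_Mapping.single (m - Poly_Mapping.single x 1) (poly_mapping.lookup p m * of_nat (poly_mapping.lookup m x)))"

lemma lookup_sym_pderiv:
  "poly_mapping.lookup (sym_pderiv x p) m =
     of_nat (Suc (poly_mapping.lookup m x)) * poly_mapping.lookup p (m + Poly_Mapping.single x 1)"
proof -
  let ?c = "\<lambda>q. poly_mapping.lookup p q * of_nat (poly_mapping.lookup q x)"
  have eq: "(q - Poly_Mapping.single x 1 = m \<and> poly_mapping.lookup q x \<noteq> 0)
      \<longleftrightarrow> q = m + Poly_Mapping.single x 1" for q :: "('a \<times> nat) \<Rightarrow>\<^sub>0 nat"
  proof
    assume *: "q - Poly_Mapping.single x 1 = m \<and> poly_mapping.lookup q x \<noteq> 0"
    show "q = m + Poly_Mapping.single x 1"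
      by (rule poly_mapping_eqI)
         (use * in \<open>auto simp: lookup_add lookup_minus lookup_single when_def\<close>)
  next
    assume "q = m + Poly_Mapping.single x 1"
    then show "q - Poly_Mapping.single x 1 = m \<and> poly_mapping.lookup q x \<noteq> 0"
      by (simp add: lookup_add)
  qed
  have "poly_mapping.lookup (sym_pderiv x p) m =
      (\<Sum>q\<in>Poly_Mapping.keys p. ?c q when q - Poly_Mapping.single x 1 = m)"
    by (simp add: sym_pderiv_def lookup_sum lookup_single)
  also have "\<dots> = (\<Sum>q\<in>Poly_Mapping.keys p. if q = m + Poly_Mapping.single x 1 then ?c q else 0)"
    by (intro sum.cong refl) (use eq in \<open>auto simp: when_def\<close>)
  also have "\<dots> = ?c (m + Poly_Mapping.single x 1)"
    by (simp add: sum.delta in_keys_iff)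
  finally show ?thesis
    by (simp add: lookup_add mult.commute)
qed

lemma sym_pderiv_add: "sym_pderiv x (p + q) = sym_pderiv x p + sym_pderiv x q"
  by (rule poly_mapping_eqI) (simp add: lookup_sym_pderiv lookup_add algebra_simps)

lemma sym_pderiv_zero [simp]: "sym_pderiv x 0 = 0"
  by (simp add: sym_pderiv_def)

lemma sym_pderiv_sum: "sym_pderiv x (sum f A) = (\<Sum>a\<in>A. sym_pderiv x (f a))"
  by (induction A rule: infinite_finite_induct) (simp_all add: sym_pderiv_add)

lemma sym_pderiv_single:
  "sym_pderiv x (Poly_Mapping.single m c) =
     Poly_Mapping.single (m - Poly_Mapping.single x 1) (c * of_nat (poly_mapping.lookup m x))"
  by (cases "c = 0") (simp_all add: sym_pderiv_def)

lemma sym_pderiv_var: "sym_pderiv x (sym_var y) = (if x = y then 1 else 0)"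
  by (auto simp: sym_var_def sym_pderiv_single lookup_single when_def)

lemma sym_pderiv_mult: "sym_pderiv x (p * q) = sym_pderiv x p * q + p * sym_pderiv x q"
proof -
  have decomp: "p = (\<Sum>m\<in>Poly_Mapping.keys p. Poly_Mapping.single m (poly_mapping.lookup p m))" for p :: "'a sym"
    by (rule poly_mapping_eqI)
       (simp add: lookup_sum lookup_single when_def sum.delta in_keys_iff)
  have shift: "(m - Poly_Mapping.single x 1) + n = (m + n) - Poly_Mapping.single x 1"
    if "poly_mapping.lookup m x \<noteq> 0" for m n :: "('a \<times> nat) \<Rightarrow>\<^sub>0 nat"
    by (rule poly_mapping_eqI) (use that in \<open>auto simp: lookup_add lookup_minus lookup_single when_def\<close>)
  have mono: "sym_pderiv x (Poly_Mapping.single m c * Poly_Mapping.single n d) =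
      sym_pderiv x (Poly_Mapping.single m c) * Poly_Mapping.single n d
      + Poly_Mapping.single m c * sym_pderiv x (Poly_Mapping.single n d)"
    for m n :: "('a \<times> nat) \<Rightarrow>\<^sub>0 nat" and c d
  proof -
    have "sym_pderiv x (Poly_Mapping.single m c) * Poly_Mapping.single n d =
        Poly_Mapping.single (m + n - Poly_Mapping.single x 1) (c * d * of_nat (poly_mapping.lookup m x))"
      using shift[of m n]
      by (cases "poly_mapping.lookup m x = 0")
         (simp_all add: sym_pderiv_single mult_single mult_ac add.commute)
    moreover have "Poly_Mapping.single m c * sym_pderiv x (Poly_Mapping.single n d) =
        Poly_Mapping.single (m + n - Poly_Mapping.single x 1) (c * d * of_nat (poly_mapping.lookup n x))"
      using shift[of n m]
      by (cases "poly_mapping.lookup n x = 0")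
         (simp_all add: sym_pderiv_single mult_single mult_ac add.commute)
    ultimately show ?thesis
      by (simp add: sym_pderiv_single mult_single lookup_add algebra_simps flip: single_add)
  qed
  have "sym_pderiv x (sum f A * sum g B) = sym_pderiv x (sum f A) * sum g B + sum f A * sym_pderiv x (sum g B)"
    if "f = (\<lambda>m. Poly_Mapping.single m (c m))" "g = (\<lambda>m. Poly_Mapping.single m (d m))"
    for f g :: "(('a \<times> nat) \<Rightarrow>\<^sub>0 nat) \<Rightarrow> 'a sym" and c d A B
    unfolding that by (simp only: sum_product sym_pderiv_sum mono sum.distrib)
  from this[OF refl refl, where A = "Poly_Mapping.keys p" and c = "poly_mapping.lookup p"
      and B = "Poly_Mapping.keys q" and d = "poly_mapping.lookup q"]
  show ?thesis
    by (simp only: decomp[symmetric])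
qed

lemma sym_pderiv_commute: "sym_pderiv x (sym_pderiv y p) = sym_pderiv y (sym_pderiv x p)"
proof (cases "x = y")
  case False
  then show ?thesis
    by (intro poly_mapping_eqI) (simp add: lookup_sym_pderiv lookup_add lookup_single add_ac)
qed simp

text \<open>The action of \<open>\<epsilon>\<^sub>i(n)\<close>, \<open>n\<close> odd; it is extended by 0 to even \<open>n\<close>.\<close>

definition sym_osc :: "'n \<Rightarrow> int \<Rightarrow> 'n sym \<Rightarrow> 'n sym" where
  "sym_osc i n p =
     (if even n then 0
      else if n < 0 then sym_var (i, nat ((- n) div 2)) * p
      else sym_const (of_int n / 2) * sym_pderiv (i, nat (n div 2)) p)"

definition fock_smult :: "complex \<Rightarrow> 'n fock \<Rightarrow> 'n fock" where
  "fock_smult c v = Poly_Mapping.map (\<lambda>p. sym_const c * p) v"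

definition osc :: "'n \<Rightarrow> int \<Rightarrow> 'n fock \<Rightarrow> 'n fock" where
  "osc i n v = Poly_Mapping.map (sym_osc i n) v"

definition heis :: "'n::finite lattice \<Rightarrow> int \<Rightarrow> 'n fock \<Rightarrow> 'n fock" where
  "heis \<alpha> n v = (\<Sum>i\<in>UNIV. fock_smult (of_int (poly_mapping.lookup \<alpha> i)) (osc i n v))"

lemma sym_const_mult: "sym_const c * sym_const d = sym_const (c * d)"
  by (simp add: sym_const_def mult_single)

lemma sym_pderiv_const: "sym_pderiv x (sym_const c * p) = sym_const c * sym_pderiv x p"
  by (simp add: sym_pderiv_mult) (simp add: sym_const_def sym_pderiv_single)

lemma sym_osc_zero [simp]: "sym_osc i n 0 = 0"
  by (simp add: sym_osc_def)

lemma sym_osc_add: "sym_osc i n (p + q) = sym_osc i n p + sym_osc i n q"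
  by (simp add: sym_osc_def sym_pderiv_add distrib_left)

lemma sym_osc_sum: "sym_osc i n (sum f A) = (\<Sum>a\<in>A. sym_osc i n (f a))"
  by (induction A rule: infinite_finite_induct) (simp_all add: sym_osc_add)

lemma sym_osc_const: "sym_osc i n (sym_const c * p) = sym_const c * sym_osc i n p"
  by (simp add: sym_osc_def sym_pderiv_const)

lemma lookup_fock_smult:
  "poly_mapping.lookup (fock_smult c v) \<beta> = sym_const c * poly_mapping.lookup v \<beta>"
  by (simp add: fock_smult_def map.rep_eq when_def)

lemma lookup_osc: "poly_mapping.lookup (osc i n v) \<beta> = sym_osc i n (poly_mapping.lookup v \<beta>)"
  by (simp add: osc_def map.rep_eq when_def)

lemma lookup_heis:
  "poly_mapping.lookup (heis \<alpha> n v) \<beta> =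
     (\<Sum>i\<in>UNIV. sym_const (of_int (poly_mapping.lookup \<alpha> i)) * sym_osc i n (poly_mapping.lookup v \<beta>))"
  by (simp add: heis_def lookup_sum lookup_fock_smult lookup_osc)

lemma sym_osc_commutator:
  assumes "odd m" "odd n"
  shows "sym_osc i m (sym_osc j n p) - sym_osc j n (sym_osc i m p) =
           (if i = j \<and> m + n = 0 then sym_const (of_int m / 2) * p else 0)"
proof -
  have idx: "nat (m div 2) = nat ((- n) div 2) \<longleftrightarrow> m + n = 0" if "m > 0" "n < 0" "odd m" "odd n" for m n :: int
    proof -
    have "nat (m div 2) = nat ((- n) div 2) \<longleftrightarrow> m div 2 = (- n) div 2"
      using that by (intro eq_nat_nat_iff) (auto simp: pos_imp_zdiv_nonneg_iff)
    also have "\<dots> \<longleftrightarrow> m + n = 0"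
      using that by presburger
    finally show ?thesis .
  qed
  have minus: "sym_const (- c) = - (sym_const c :: 'a sym)" for c
    by (simp add: sym_const_def single_uminus)
  consider "m < 0" "n < 0" | "m > 0" "n > 0" | "m > 0" "n < 0" | "m < 0" "n > 0"
    using assms by (metis even_zero linorder_neqE_linordered_idom)
  then show ?thesis
  proof cases
    case 1
    then show ?thesis by (simp add: sym_osc_def assms mult_ac)
  next
    case 2
    then show ?thesis
      by (simp add: sym_osc_def assms sym_pderiv_const sym_pderiv_commute[of "(i, _)"])
  next
    case 3
    then show ?thesis
      using idx[of m n] assms
      by (auto simp: sym_osc_def sym_pderiv_mult sym_pderiv_var algebra_simps)
  next
    case 4
    have neg: "sym_const (of_int m / 2) = - (sym_const (of_int n / 2) :: 'a sym)" if "m + n = 0"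
    proof -
      from that have "m = - n" by simp
      then show ?thesis using minus[of "of_int n / 2"] by simp
    qed
    from 4 show ?thesis
      using idx[of n m] assms neg
      by (auto simp: sym_osc_def sym_pderiv_mult sym_pderiv_var algebra_simps)
  qed
qed

lemma heis_commutator:
  assumes "odd m" "odd n"
  shows "heis \<alpha> m (heis \<beta> n v) - heis \<beta> n (heis \<alpha> m v) =
           (if m + n = 0 then fock_smult (of_int m / 2 * of_int (lattice_form \<alpha> \<beta>)) v else 0)"
proof (rule poly_mapping_eqI)
  fix \<gamma>
  let ?p = "poly_mapping.lookup v \<gamma>"
  let ?a = "\<lambda>i. sym_const (of_int (poly_mapping.lookup \<alpha> i)) :: 'a sym"
  let ?b = "\<lambda>i. sym_const (of_int (poly_mapping.lookup \<beta> i)) :: 'a sym"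
  have "poly_mapping.lookup (heis \<alpha> m (heis \<beta> n v) - heis \<beta> n (heis \<alpha> m v)) \<gamma> =
      (\<Sum>i\<in>UNIV. \<Sum>j\<in>UNIV. ?a i * ?b j * sym_osc i m (sym_osc j n ?p))
      - (\<Sum>j\<in>UNIV. \<Sum>i\<in>UNIV. ?a i * ?b j * sym_osc j n (sym_osc i m ?p))"
    by (simp add: lookup_minus lookup_heis sym_osc_sum sym_osc_const sum_distrib_left mult_ac)
  also have "(\<Sum>j\<in>UNIV. \<Sum>i\<in>UNIV. ?a i * ?b j * sym_osc j n (sym_osc i m ?p)) =
      (\<Sum>i\<in>UNIV. \<Sum>j\<in>UNIV. ?a i * ?b j * sym_osc j n (sym_osc i m ?p))"
    by (rule sum.swap)
  also have "(\<Sum>i\<in>UNIV. \<Sum>j\<in>UNIV. ?a i * ?b j * sym_osc i m (sym_osc j n ?p)) - \<dots> =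
      (\<Sum>i\<in>UNIV. \<Sum>j\<in>UNIV. ?a i * ?b j *
         (sym_osc i m (sym_osc j n ?p) - sym_osc j n (sym_osc i m ?p)))"
    by (simp only: sum_subtractf right_diff_distrib)
  also have "\<dots> = (\<Sum>i\<in>UNIV. \<Sum>j\<in>UNIV. if i = j then
      (if m + n = 0 then ?a i * ?b i * (sym_const (of_int m / 2) * ?p) else 0) else 0)"
    unfolding sym_osc_commutator[OF assms] by (intro sum.cong refl) auto
  also have "\<dots> = (\<Sum>i\<in>UNIV.
      if m + n = 0 then ?a i * ?b i * (sym_const (of_int m / 2) * ?p) else 0)"
    by simp
  also have "\<dots> = (if m + n = 0 then
      (\<Sum>i\<in>UNIV. ?a i * ?b i) * (sym_const (of_int m / 2) * ?p) else 0)"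
    by (simp add: sum_distrib_right)
  also have "(\<Sum>i\<in>UNIV. ?a i * ?b i) = sym_const (of_int (lattice_form \<alpha> \<beta>))"
  proof -
    have "sym_const (sum f A) = (\<Sum>i\<in>A. sym_const (f i) :: 'a sym)" for f :: "'a \<Rightarrow> complex" and A
      unfolding sym_const_def by (induction A rule: infinite_finite_induct) (simp_all add: single_add)
    then show ?thesis
      by (simp add: lattice_form_def sym_const_mult)
  qed
  finally show "poly_mapping.lookup (heis \<alpha> m (heis \<beta> n v) - heis \<beta> n (heis \<alpha> m v)) \<gamma> =
      poly_mapping.lookup (if m + n = 0 then
        fock_smult (of_int m / 2 * of_int (lattice_form \<alpha> \<beta>)) v else 0) \<gamma>"
    by (simp add: lookup_fock_smult sym_const_mult mult_ac flip: mult.assoc)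
qed

text \<open>Left multiplication by \<open>e\<^sup>\<alpha>\<close> in the twisted group algebra.\<close>

definition group_op :: "'n::{finite,linorder} lattice_mod2 \<Rightarrow> 'n fock \<Rightarrow> 'n fock" where
  "group_op \<alpha> v = (\<Sum>\<beta>\<in>Poly_Mapping.keys v.
     Poly_Mapping.single (\<alpha> + \<beta>) (sym_const (cocycle_mod2 \<alpha> \<beta>) * poly_mapping.lookup v \<beta>))"


section \<open>Formal series of operators\<close>

text \<open>
  \<open>A m\<close> is the coefficient of \<open>z\<^sup>m\<close> in \<open>A(z)\<close>, and \<open>F m n\<close> is the coefficient of \<open>z\<^sup>m w\<^sup>n\<close> in
  \<open>F(z,w)\<close>. Sums and differences of series are the pointwise ones. Infinite sums of operators are
  evaluated on each vector by \<^const>\<open>Sum_any\<close>, which would return 0 on a family of infinite support.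
  All supports occurring below are finite: the factors \<open>E\<^sub>-\<close> have only nonnegative powers of \<open>z\<close>, the
  factors \<open>E\<^sub>+\<close> only nonpositive ones, of which all but finitely many vanish on a given vector
  (\<open>\<epsilon>\<^sub>i(n)\<close> kills it for all large \<open>n\<close>), and the \<open>k\<close>-th power of an exponent only involves
  \<open>z\<^sup>m\<close> with \<open>\<bar>m\<bar> \<ge> k\<close>.
\<close>

type_synonym 'n op_series = "int \<Rightarrow> 'n fock \<Rightarrow> 'n fock"
type_synonym 'n op_series2 = "int \<Rightarrow> int \<Rightarrow> 'n fock \<Rightarrow> 'n fock"

definition series_const :: "complex \<Rightarrow> 'n op_series" where
  "series_const c = (\<lambda>m v. if m = 0 then fock_smult c v else 0)"

definition series_smult :: "complex \<Rightarrow> 'n op_series \<Rightarrow> 'n op_series" where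
  "series_smult c A = (\<lambda>m v. fock_smult c (A m v))"

definition series_mult :: "'n op_series \<Rightarrow> 'n op_series \<Rightarrow> 'n op_series" (infixr \<open>\<odot>\<close> 70) where
  "A \<odot> B = (\<lambda>m v. Sum_any (\<lambda>p. A p (B (m - p) v)))"

definition series_exp :: "'n op_series \<Rightarrow> 'n op_series" where
  "series_exp A = (\<lambda>m v. Sum_any (\<lambda>k::nat.
     fock_smult (1 / fact k) ((((\<odot>) A) ^^ k) (series_const 1) m v)))"

text \<open>\<open>A(cz)\<close>\<close>

definition series_rescale :: "complex \<Rightarrow> 'n op_series \<Rightarrow> 'n op_series" where
  "series_rescale c A = (\<lambda>m v. fock_smult (c powi m) (A m v))"

text \<open>\<open>exp(-2 \<Sum>\<^bsub>n \<in> N\<^esub> \<alpha>(n)/n z\<^bsup>-n\<^esup>)\<close>\<close>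

definition exp_half :: "int set \<Rightarrow> 'n::finite lattice \<Rightarrow> 'n op_series" where
  "exp_half N \<alpha> = series_exp
     (\<lambda>m v. if - m \<in> N then fock_smult (- 2 / of_int (- m)) (heis \<alpha> (- m) v) else 0)"

definition E_plus :: "'n::finite lattice \<Rightarrow> 'n op_series" where
  "E_plus = exp_half {n. odd n \<and> n > 0}"

definition E_minus :: "'n::finite lattice \<Rightarrow> 'n op_series" where
  "E_minus = exp_half {n. odd n \<and> n < 0}"

definition E_prod :: "'n::finite \<Rightarrow> 'n \<Rightarrow> complex \<Rightarrow> 'n op_series" where
  "E_prod i j a =
     E_minus (eps_vec i) \<odot> series_rescale a (E_minus (- eps_vec j)) \<odot>
     E_plus (eps_vec i) \<odot> series_rescale a (E_plus (- eps_vec j))"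

definition eps_series :: "'n \<Rightarrow> 'n op_series" where
  "eps_series i = (\<lambda>m v. if odd m then osc i (- m) v else 0)"

definition X :: "'n::{finite,linorder} \<Rightarrow> 'n \<Rightarrow> complex \<Rightarrow> 'n op_series" where
  "X i j a =
     (if i \<noteq> j then
        (\<lambda>m v. fock_smult (cocycle (eps_vec i) (eps_vec j))
           (group_op (mod2 (eps_vec i - eps_vec j)) (E_prod i j a m v)))
      else if a = 1 then series_smult 4 (eps_series i)
      else series_smult ((1 + a) / (1 - a)) (E_prod i i a - series_const 1))"

definition op_bracket :: "'n op_series \<Rightarrow> 'n op_series \<Rightarrow> 'n op_series2" where
  "op_bracket A B = (\<lambda>m n v. A m (B n v) - B n (A m v))"

definition delta :: "int \<Rightarrow> complex" where
  "delta n = 1"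

definition D_delta :: "int \<Rightarrow> complex" where
  "D_delta n = of_int n"

text \<open>\<open>f(cw/z)\<close>\<close>

definition at_ratio :: "(int \<Rightarrow> complex) \<Rightarrow> complex \<Rightarrow> int \<Rightarrow> int \<Rightarrow> complex" where
  "at_ratio f c = (\<lambda>m n. if m = - n then f n * c powi n else 0)"

text \<open>\<open>A(z) f(z,w)\<close>\<close>

definition series_times :: "'n op_series \<Rightarrow> (int \<Rightarrow> int \<Rightarrow> complex) \<Rightarrow> 'n op_series2"
    (infixl \<open>\<otimes>\<close> 70) where
  "A \<otimes> f = (\<lambda>m n v. Sum_any (\<lambda>p. fock_smult (f p n) (A (m - p) v)))"

definition series2_smult :: "complex \<Rightarrow> 'n op_series2 \<Rightarrow> 'n op_series2" (infixr \<open>\<bullet>\<close> 69) where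
  "c \<bullet> F = (\<lambda>m n v. fock_smult c (F m n v))"

definition const_term :: "'n \<Rightarrow> 'n \<Rightarrow> complex \<Rightarrow> complex" where
  "const_term i l c = (if i = l \<and> c \<noteq> 1 then (1 + c) / (1 - c) else 0)"

end

theory Submission
  imports Defs "HOL-Computational_Algebra.Formal_Power_Series"
begin

text \<open>
  The identity is a computation with free fermions. Since every exponent \<open>n\<close> in \<open>E\<^sub>\<plusminus>\<close> is odd,
  \<open>E\<^sub>\<plusminus>(-\<alpha>,z) = E\<^sub>\<plusminus>(\<alpha>,-z)\<close>, and \<open>X\<^sub>i\<^sub>j(a,z)\<close> looks like a product of the two fields \<open>\<psi>\<^sub>i(z)\<close> and
  \<open>\<psi>\<^sub>j(-az)\<close>, where \<open>\<psi>\<^sub>i(z) = e\<^sup>\<epsilon>\<^sub>i E\<^sub>-(\<epsilon>\<^sub>i,z) E\<^sub>+(\<epsilon>\<^sub>i,z)\<close>. Exchanging \<open>E\<^sub>+\<close> and \<open>E\<^sub>-\<close> produces the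
  factor \<open>(1 - w/z) / (1 + w/z)\<close>, expanded in \<open>w/z\<close>; the two expansions of this function differ by
  \<open>2 \<delta>(-w/z)\<close>, and the cocycle makes different indices anticommute, so that the modes of the \<open>\<psi>\<^sub>i\<close>
  satisfy the Clifford relations
  \<open>\<psi>\<^sub>i(m) \<psi>\<^sub>j(n) + \<psi>\<^sub>j(n) \<psi>\<^sub>i(m) = 2 (-1)\<^sup>n\<close> if \<open>i = j\<close> and \<open>m + n = 0\<close>, and \<open>= 0\<close> otherwise
  (\<open>fermion_anticommute\<close>).

  The value of \<open>\<psi>\<^sub>i(z) \<psi>\<^sub>j(w)\<close> at \<open>w = -az\<close> is an infinite sum of modes. Subtracting from
  \<open>\<psi>\<^sub>i(m) \<psi>\<^sub>j(n)\<close> its vacuum expectation gives the normally ordered pair \<open>:\<psi>\<^sub>i(m) \<psi>\<^sub>j(n):\<close>, for which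
  the sum is finite on every vector, and in all three cases of its definition
  \<open>X\<^sub>i\<^sub>j(a,z) = \<Sum>\<^sub>m\<^sub>,\<^sub>n (-a)\<^sup>n :\<psi>\<^sub>i(m) \<psi>\<^sub>j(n): z\<^bsup>m+n\<^esup>\<close> (\<open>X_eq_bilinear\<close>). In particular \<open>4 \<epsilon>\<^sub>i(z)\<close> is the
  case \<open>i = j\<close>, \<open>a = 1\<close> of the same formula.

  The bracket of two bilinears in fermions is then a sum of four bilinears, one for each possible
  contraction, and this gives the four delta function terms. Normal ordering of these four bilinears
  leaves a scalar, in which two infinite sums cancel up to the finite sum
  \<open>\<Sum>\<^sub>n c\<^sup>n (sgn n - sgn (n - N))\<close> with \<open>c = ab\<close> or \<open>c = b/a\<close> (\<open>sign_sum_eq\<close>). For \<open>c \<noteq> 1\<close> it is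
  \<open>(1 + c) / (1 - c) (1 - c\<^sup>N)\<close> and accounts for the constants next to \<open>X\<close>; for \<open>c = 1\<close> it is \<open>2N\<close> and
  accounts for the derivatives of the delta function.

  Both the Clifford relations and the mode expansion of \<open>X\<close> are equalities of operators that have
  the same commutators with the Heisenberg algebra. Since the Fock space is generated from the vacuum
  vectors \<open>e\<^sup>\<beta> \<otimes> 1\<close> by the creation operators, and a vector annihilated by all annihilation operators
  is a combination of vacuum vectors, such equalities only have to be checked on vacuum expectations
  (\<open>heis_closed_family_eq_zero\<close>).
\<close>

section \<open>Linear operators on the Fock space\<close>

notation fock_smult (infixr \<open>\<cdot>\<close> 75)

global_interpretation fock: vector_space "fock_smult :: complex \<Rightarrow> 'n fock \<Rightarrow> 'n fock"
proof
  have const_add: "sym_const (c + d) = (sym_const c + sym_const d :: 'n sym)" for c d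
    by (simp add: sym_const_def single_add)
  have const_one: "sym_const 1 = (1 :: 'n sym)"
    by (simp add: sym_const_def)
  fix c d :: complex and u v :: "'n fock"
  show "c \<cdot> (u + v) = c \<cdot> u + c \<cdot> v"
    by (rule poly_mapping_eqI) (simp add: lookup_fock_smult lookup_add distrib_left)
  show "(c + d) \<cdot> v = c \<cdot> v + d \<cdot> v"
    by (rule poly_mapping_eqI) (simp add: lookup_fock_smult lookup_add const_add distrib_right)
  show "c \<cdot> d \<cdot> v = (c * d) \<cdot> v"
    by (rule poly_mapping_eqI) (simp add: lookup_fock_smult sym_const_mult flip: mult.assoc)
  show "1 \<cdot> v = v"
    by (rule poly_mapping_eqI) (simp add: lookup_fock_smult const_one)
qed

abbreviation linear_op :: "('n fock \<Rightarrow> 'n fock) \<Rightarrow> bool" where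
  "linear_op \<equiv> module_hom fock_smult fock_smult"

lemma linear_opI:
  assumes "\<And>u v. T (u + v) = T u + T v" and "\<And>c v. T (c \<cdot> v) = c \<cdot> T v"
  shows "linear_op T"
  using assms by (intro module_hom.intro module_hom_axioms.intro fock.module_axioms)

lemma linear_op_scale: "linear_op T \<Longrightarrow> linear_op (\<lambda>v. c \<cdot> T v)"
  by (rule linear_opI) (simp_all add: module_hom.add module_hom.scale fock.scale_right_distrib mult.commute)

lemma linear_op_comp: "linear_op S \<Longrightarrow> linear_op T \<Longrightarrow> linear_op (\<lambda>v. S (T v))"
  by (rule linear_opI) (simp_all add: module_hom.add module_hom.scale)

lemma linear_op_add: "linear_op S \<Longrightarrow> linear_op T \<Longrightarrow> linear_op (\<lambda>v. S v + T v)"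
  by (rule linear_opI) (simp_all add: module_hom.add module_hom.scale fock.scale_right_distrib)

lemma linear_op_diff: "linear_op S \<Longrightarrow> linear_op T \<Longrightarrow> linear_op (\<lambda>v. S v - T v)"
  by (rule linear_opI) (simp_all add: module_hom.add module_hom.scale fock.scale_right_diff_distrib)

lemma linear_op_id: "linear_op (\<lambda>v. v)" and linear_op_zero: "linear_op (\<lambda>v. 0)"
  by (rule linear_opI; simp)+

lemma linear_op_if: "linear_op S \<Longrightarrow> linear_op T \<Longrightarrow> linear_op (\<lambda>v. if P then S v else T v)"
  by (cases P) simp_all

lemma linear_op_osc: "linear_op (osc i n)"
proof (rule linear_opI)
  show "osc i n (u + v) = osc i n u + osc i n v" for u v
    by (rule poly_mapping_eqI) (simp add: lookup_osc lookup_add sym_osc_add)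
  show "osc i n (c \<cdot> v) = c \<cdot> osc i n v" for c v
    by (rule poly_mapping_eqI) (simp add: lookup_osc lookup_fock_smult sym_osc_const)
qed

lemma lookup_group_op:
  "poly_mapping.lookup (group_op \<alpha> v) \<beta> =
     sym_const (cocycle_mod2 \<alpha> (\<beta> - \<alpha>)) * poly_mapping.lookup v (\<beta> - \<alpha>)"
proof -
  have "poly_mapping.lookup (group_op \<alpha> v) \<beta> = (\<Sum>\<gamma>\<in>Poly_Mapping.keys v.
      if \<gamma> = \<beta> - \<alpha> then sym_const (cocycle_mod2 \<alpha> \<gamma>) * poly_mapping.lookup v \<gamma> else 0)"
    unfolding group_op_def lookup_sum
    by (intro sum.cong refl) (auto simp: lookup_single when_def algebra_simps)
  then show ?thesis
    by (simp add: sum.delta in_keys_iff)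
qed

lemma linear_op_group_op: "linear_op (group_op \<alpha>)"
proof (rule linear_opI)
  show "group_op \<alpha> (u + v) = group_op \<alpha> u + group_op \<alpha> v" for u v
    by (rule poly_mapping_eqI) (simp add: lookup_group_op lookup_add distrib_left)
  show "group_op \<alpha> (c \<cdot> v) = c \<cdot> group_op \<alpha> v" for c v
    by (rule poly_mapping_eqI) (simp add: lookup_group_op lookup_fock_smult ac_simps)
qed

lemma osc_group_op: "osc i n (group_op \<alpha> v) = group_op \<alpha> (osc i n v)"
  by (rule poly_mapping_eqI) (simp add: lookup_osc lookup_group_op sym_osc_const)

lemma cocycle_mod2_add_left:
  "cocycle_mod2 (\<alpha> + \<alpha>') \<beta> = cocycle_mod2 \<alpha> \<beta> * cocycle_mod2 \<alpha>' \<beta>"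
  by transfer (rule cocycle_add_left)

lemma cocycle_mod2_add_right:
  "cocycle_mod2 \<alpha> (\<beta> + \<beta>') = cocycle_mod2 \<alpha> \<beta> * cocycle_mod2 \<alpha> \<beta>'"
  by transfer (rule cocycle_add_right)

lemma group_op_group_op: "group_op \<alpha> (group_op \<beta> v) = cocycle_mod2 \<alpha> \<beta> \<cdot> group_op (\<alpha> + \<beta>) v"
proof (rule poly_mapping_eqI)
  fix \<gamma>
  have "cocycle_mod2 \<alpha> (\<gamma> - \<alpha>) = cocycle_mod2 \<alpha> \<beta> * cocycle_mod2 \<alpha> (\<gamma> - \<alpha> - \<beta>)"
    by (simp flip: cocycle_mod2_add_right)
  then show "poly_mapping.lookup (group_op \<alpha> (group_op \<beta> v)) \<gamma> =
      poly_mapping.lookup (cocycle_mod2 \<alpha> \<beta> \<cdot> group_op (\<alpha> + \<beta>) v) \<gamma>"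
    by (simp add: lookup_group_op lookup_fock_smult cocycle_mod2_add_left sym_const_mult
        diff_diff_eq flip: mult.assoc)
qed

lemma osc_commutator:
  assumes "odd m" "odd n"
  shows "osc i m (osc j n v) - osc j n (osc i m v) = (of_int m / 2 * of_bool (i = j \<and> m + n = 0)) \<cdot> v"
  by (rule poly_mapping_eqI)
     (auto simp: lookup_minus lookup_osc sym_osc_commutator[OF assms] lookup_fock_smult sym_const_def)

section \<open>Vacuum vectors and the uniqueness principle\<close>

definition vacuum :: "'n lattice_mod2 \<Rightarrow> 'n fock" where
  "vacuum \<beta> = Poly_Mapping.single \<beta> 1"

text \<open>
  The coefficient of \<open>e\<^sup>\<beta> \<otimes> 1\<close>. Applied to \<open>T (vacuum \<gamma>)\<close> it is a vacuum matrix element of \<open>T\<close>.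
\<close>

definition vac_coeff :: "'n lattice_mod2 \<Rightarrow> 'n fock \<Rightarrow> complex" where
  "vac_coeff \<beta> v = poly_mapping.lookup (poly_mapping.lookup v \<beta>) 0"

lemma osc_vacuum: "n > 0 \<Longrightarrow> osc i n (vacuum \<beta>) = 0"
  by (rule poly_mapping_eqI)
     (auto simp: vacuum_def lookup_osc lookup_single when_def sym_osc_def sym_pderiv_single simp flip: single_one)


lemma lookup_sym_const_mult: "poly_mapping.lookup (sym_const c * p) m = c * poly_mapping.lookup p m"
  by (simp add: sym_const_def map.rep_eq when_def flip: mult_map_scale_conv_mult)

lemma linear_op_sum_any:
  assumes "linear_op T" and "finite {p. f p \<noteq> 0}"
  shows "T (Sum_any f) = Sum_any (\<lambda>p. T (f p))"
proof -
  have "{p. T (f p) \<noteq> 0} \<subseteq> {p. f p \<noteq> 0}"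
    using module_hom.zero[OF assms(1)] by force
  then have "Sum_any (\<lambda>p. T (f p)) = (\<Sum>p\<in>{p. f p \<noteq> 0}. T (f p))"
    by (rule Sum_any.expand_superset[OF assms(2)])
  then show ?thesis
    by (simp add: Sum_any.expand_set module_hom.sum[OF assms(1)])
qed

lemma vac_coeff_add: "vac_coeff \<beta> (u + v) = vac_coeff \<beta> u + vac_coeff \<beta> v"
  and vac_coeff_diff: "vac_coeff \<beta> (u - v) = vac_coeff \<beta> u - vac_coeff \<beta> v"
  and vac_coeff_zero [simp]: "vac_coeff \<beta> 0 = 0"
  and vac_coeff_scale: "vac_coeff \<beta> (c \<cdot> v) = c * vac_coeff \<beta> v"
  by (simp_all add: vac_coeff_def lookup_add lookup_minus lookup_fock_smult lookup_sym_const_mult)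

lemma vac_coeff_sum_any:
  assumes "finite {p. f p \<noteq> 0}"
  shows "vac_coeff \<beta> (Sum_any f) = Sum_any (\<lambda>p. vac_coeff \<beta> (f p))"
proof -
  have "{p. vac_coeff \<beta> (f p) \<noteq> 0} \<subseteq> {p. f p \<noteq> 0}"
    by auto
  then have "Sum_any (\<lambda>p. vac_coeff \<beta> (f p)) = (\<Sum>p\<in>{p. f p \<noteq> 0}. vac_coeff \<beta> (f p))"
    by (rule Sum_any.expand_superset[OF assms])
  moreover have "vac_coeff \<beta> (sum f A) = (\<Sum>p\<in>A. vac_coeff \<beta> (f p))" for A
    by (induction A rule: infinite_finite_induct) (simp_all add: vac_coeff_add)
  ultimately show ?thesis
    by (simp add: Sum_any.expand_set)
qed

lemma vac_coeff_vacuum: "vac_coeff \<beta> (vacuum \<gamma>) = of_bool (\<beta> = \<gamma>)"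
  by (simp add: vac_coeff_def vacuum_def lookup_single when_def)

lemma vac_coeff_osc_creation:
  fixes v :: "'n fock"
  assumes "n < 0"
  shows "vac_coeff \<beta> (osc i n v) = 0"
proof -
  have "poly_mapping.lookup (sym_var x * p) 0 = 0" for x :: "'n \<times> nat" and p :: "'n sym"
  proof -
    have "Poly_Mapping.single x 1 + m \<noteq> (0 :: ('n \<times> nat) \<Rightarrow>\<^sub>0 nat)" for m
    proof
      assume "Poly_Mapping.single x 1 + m = 0"
      then have "poly_mapping.lookup (Poly_Mapping.single x 1 + m) x = 0" by simp
      then show False by (simp add: lookup_add)
    qed
    then have "0 \<notin> Poly_Mapping.keys (sym_var x * p)"
      using keys_mult[of "sym_var x" p] by (auto simp: sym_var_def)
    then show ?thesis
      by (simp add: in_keys_iff)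
  qed
  then show ?thesis
    using assms by (simp add: vac_coeff_def lookup_osc sym_osc_def)
qed

lemma vac_coeff_group_op:
  "vac_coeff \<beta> (group_op \<alpha> v) = cocycle_mod2 \<alpha> (\<beta> - \<alpha>) * vac_coeff (\<beta> - \<alpha>) v"
  by (simp add: vac_coeff_def lookup_group_op lookup_sym_const_mult)

lemma monomial_induct [case_names zero var]:
  fixes m :: "'x \<Rightarrow>\<^sub>0 nat"
  assumes "P 0" and "\<And>m x. P m \<Longrightarrow> P (m + Poly_Mapping.single x 1)"
  shows "P m"
proof (induction m rule: update_induct)
  case const
  show ?case by fact
next
  case (update m x d)
  have "P (m + Poly_Mapping.single x d)" for d
  proof (induction d)
    case 0
    show ?case using update.IH by simp
  next
    case (Suc d)
    then show ?case
      using assms(2)[of "m + Poly_Mapping.single x d" x] by (simp add: add.assoc flip: single_add)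
  qed
  moreover have "Poly_Mapping.update x d m = m + Poly_Mapping.single x d"
    using update.hyps by (intro poly_mapping_eqI) (auto simp: lookup_update lookup_add lookup_single when_def in_keys_iff)
  ultimately show ?case by simp
qed

text \<open>
  The monomials are obtained from the vacuum vectors by applying creation operators one variable at a
  time.
\<close>

lemma fock_induct [case_names add scale vacuum creation]:
  assumes add: "\<And>u v. P u \<Longrightarrow> P v \<Longrightarrow> P (u + v)"
    and scale: "\<And>c v. P v \<Longrightarrow> P (c \<cdot> v)"
    and vacuum: "\<And>\<beta>. P (vacuum \<beta>)"
    and creation: "\<And>i n v. odd n \<Longrightarrow> n < 0 \<Longrightarrow> P v \<Longrightarrow> P (osc i n v)"
  shows "P v"
proof -
  have zero: "P 0"
    using scale[OF vacuum, of 0] by simp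
  have monomial: "P (Poly_Mapping.single \<beta> (Poly_Mapping.single m 1))" for \<beta> m
  proof (induction m rule: monomial_induct)
    case zero
    show ?case using vacuum[of \<beta>] by (simp add: vacuum_def)
  next
    case (var m x)
    obtain i r where x: "x = (i, r)" by (cases x)
    have "nat ((2 * int r + 1) div 2) = r"
      by simp
    then have "sym_osc i (- (2 * int r + 1)) (Poly_Mapping.single m 1) =
        Poly_Mapping.single (m + Poly_Mapping.single x 1) 1"
      unfolding sym_osc_def x sym_var_def by (simp add: mult_single add.commute)
    then have eq: "osc i (- (2 * int r + 1)) (Poly_Mapping.single \<beta> (Poly_Mapping.single m 1)) =
        Poly_Mapping.single \<beta> (Poly_Mapping.single (m + Poly_Mapping.single x 1) 1)"
      by (intro poly_mapping_eqI) (simp add: lookup_osc lookup_single when_def del: mult_minus_left minus_add_distrib)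
    have "P (osc i (- (2 * int r + 1)) (Poly_Mapping.single \<beta> (Poly_Mapping.single m 1)))"
      by (rule creation) (simp_all add: var)
    then show ?case
      by (simp only: eq)
  qed
  have sums: "P (sum f A)" if "\<And>a. P (f a)" for f :: "'b \<Rightarrow> 'a fock" and A
    using that by (induction A rule: infinite_finite_induct) (auto intro: add zero)
  have "P (Poly_Mapping.single \<beta> p)" for \<beta> p
  proof -
    have "(\<Sum>m\<in>Poly_Mapping.keys p. poly_mapping.lookup p m \<cdot> Poly_Mapping.single \<beta> (Poly_Mapping.single m 1))
        = Poly_Mapping.single \<beta> p"
    proof (rule poly_mapping_eqI, rule poly_mapping_eqI)
      fix \<gamma> m
      show "poly_mapping.lookup (poly_mapping.lookup (\<Sum>m\<in>Poly_Mapping.keys p. poly_mapping.lookup p m \<cdot>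
            Poly_Mapping.single \<beta> (Poly_Mapping.single m 1)) \<gamma>) m =
          poly_mapping.lookup (poly_mapping.lookup (Poly_Mapping.single \<beta> p) \<gamma>) m"
        by (auto simp: lookup_sum lookup_fock_smult lookup_single when_def lookup_sym_const_mult
            sum.delta' in_keys_iff if_distrib[of "\<lambda>x. _ * x"] cong: if_cong)
    qed
    moreover have "P (\<Sum>m\<in>Poly_Mapping.keys p. poly_mapping.lookup p m \<cdot> Poly_Mapping.single \<beta> (Poly_Mapping.single m 1))"
      by (intro sums scale monomial)
    ultimately show ?thesis by simp
  qed
  then have "P (\<Sum>\<beta>\<in>Poly_Mapping.keys v. Poly_Mapping.single \<beta> (poly_mapping.lookup v \<beta>))"
    by (intro sums)
  also have "(\<Sum>\<beta>\<in>Poly_Mapping.keys v. Poly_Mapping.single \<beta> (poly_mapping.lookup v \<beta>)) = v"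
    by (rule poly_mapping_eqI) (simp add: lookup_sum lookup_single when_def sum.delta' in_keys_iff)
  finally show ?thesis .
qed

text \<open>
  The uniqueness principle for operators on the Fock space. The hypothesis on the commutators is
  homogeneous in the family, so that it turns information on all the \<open>T\<^sub>t\<close> at one vector into
  information on \<open>T\<^sub>s\<close> at the next one. On a vacuum vector annihilation operators kill the argument, hence
  all partial derivatives of \<open>T\<^sub>s (e\<^sup>\<beta> \<otimes> 1)\<close> are combinations of the vectors \<open>T\<^sub>t (e\<^sup>\<beta> \<otimes> 1)\<close>, and
  the coefficients of these vectors vanish by induction on the degree, starting from the vacuum matrix
  elements. Creation operators then carry the vanishing from the vacuum vectors to the whole space.
\<close>

lemma heis_closed_family_eq_zero:
  fixes T :: "'s \<Rightarrow> 'n fock \<Rightarrow> 'n fock"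
  assumes lin: "\<And>s. linear_op (T s)"
    and comm: "\<And>k n s v. odd n \<Longrightarrow> osc k n (T s v) - T s (osc k n v) \<in> fock.span (range (\<lambda>t. T t v))"
    and vac: "\<And>s \<beta> \<gamma>. vac_coeff \<gamma> (T s (vacuum \<beta>)) = 0"
  shows "T s v = 0"
proof (induction v arbitrary: s rule: fock_induct)
  case (add u v)
  then show ?case by (simp add: module_hom.add[OF lin])
next
  case (scale c v)
  then show ?case by (simp add: module_hom.scale[OF lin])
next
  case (vacuum \<beta>)
  have "\<forall>s \<gamma>. poly_mapping.lookup (poly_mapping.lookup (T s (vacuum \<beta>)) \<gamma>) m = 0" for m
  proof (induction m rule: monomial_induct)
    case zero
    show ?case using vac by (simp add: vac_coeff_def)
  next
    case (var m x)
    obtain k r where x: "x = (k, r)" by (cases x)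
    \<comment> \<open>the mode of the annihilation operator that differentiates by the variable \<open>(k, r)\<close>\<close>
    define n where "n = 2 * int r + 1"
    show ?case
    proof (intro allI)
      fix s \<gamma>
      have "osc k n (T s (vacuum \<beta>)) \<in> fock.span (range (\<lambda>t. T t (vacuum \<beta>)))"
        using comm[of n k s "vacuum \<beta>"]
        by (simp add: n_def osc_vacuum module_hom.zero[OF lin])
      then have "poly_mapping.lookup (poly_mapping.lookup (osc k n (T s (vacuum \<beta>))) \<gamma>) m = 0"
      proof (induction rule: fock.span_induct_alt)
        case base
        show ?case by simp
      next
        case (step c u w)
        then show ?case using var
          by (auto simp: lookup_add lookup_fock_smult lookup_sym_const_mult)
      qed
      moreover have "nat (n div 2) = r" and "n > 0" and "odd n"
        by (simp_all add: n_def)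
      ultimately show "poly_mapping.lookup (poly_mapping.lookup (T s (vacuum \<beta>)) \<gamma>) (m + Poly_Mapping.single x 1) = 0"
        by (auto simp: x lookup_osc sym_osc_def lookup_sym_const_mult lookup_sym_pderiv simp flip: of_nat_Suc)
    qed
  qed
  then show ?case
    by (intro poly_mapping_eqI) simp
next
  case (creation i n v)
  have "range (\<lambda>t. T t v) = {0}"
    using creation.IH by auto
  then have "osc i n (T s v) - T s (osc i n v) = 0"
    using comm[OF creation.hyps(1), of i s v] by simp
  then show ?case
    using creation.IH by (simp add: module_hom.zero[OF linear_op_osc])
qed

section \<open>Products of series of operators\<close>

definition linear_series :: "'n op_series \<Rightarrow> bool" where
  "linear_series A \<longleftrightarrow> (\<forall>m. linear_op (A m))"

text \<open>
  Under this condition \<^const>\<open>Sum_any\<close> computes the coefficients of \<open>A \<odot> B\<close> as the intended sums rather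
  than as the default value 0.
\<close>

definition summable_product :: "'n op_series \<Rightarrow> 'n op_series \<Rightarrow> bool" where
  "summable_product A B \<longleftrightarrow> (\<forall>m v. finite {p. A p (B (m - p) v) \<noteq> 0})"

text \<open>
  In terms of generating series: \<open>[\<epsilon>\<^sub>k(n), A(z)] = c\<^sub>k\<^sub>,\<^sub>n z\<^sup>n A(z)\<close>. Every factor of the vertex operators is of
  this kind, and weights add up under products.
\<close>

definition heis_weight :: "('n \<Rightarrow> int \<Rightarrow> complex) \<Rightarrow> 'n op_series \<Rightarrow> bool" where
  "heis_weight c A \<longleftrightarrow> (\<forall>k n m v. odd n \<longrightarrow>
     osc k n (A m v) - A m (osc k n v) = c k n \<cdot> A (m - n) v)"

lemma linear_series_zero: "linear_series A \<Longrightarrow> A m 0 = 0"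
  and linear_series_add: "linear_series A \<Longrightarrow> A m (u + v) = A m u + A m v"
  and linear_series_scale: "linear_series A \<Longrightarrow> A m (c \<cdot> v) = c \<cdot> A m v"
  unfolding linear_series_def by (metis module_hom.zero module_hom.add module_hom.scale)+

lemma finite_support_add:
  fixes f g :: "'b \<Rightarrow> 'c::comm_monoid_add"
  assumes "finite {p. f p \<noteq> 0}" and "finite {p. g p \<noteq> 0}"
  shows "finite {p. f p + g p \<noteq> 0}"
  by (rule finite_subset[OF _ finite_UnI[OF assms]]) auto

lemma finite_support_linear_op:
  assumes "linear_op T" and "finite {p. f p \<noteq> 0}"
  shows "finite {p. T (f p) \<noteq> 0}"
  by (rule finite_subset[OF _ assms(2)]) (use module_hom.zero[OF assms(1)] in auto)

lemma linear_op_sum_any_family: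
  assumes lin: "\<And>p. linear_op (T p)" and fin: "\<And>v. finite {p. T p v \<noteq> 0}"
  shows "linear_op (\<lambda>v. Sum_any (\<lambda>p. T p v))"
  by (rule linear_opI)
     (simp_all add: module_hom.add[OF lin] module_hom.scale[OF lin] Sum_any.distrib[OF fin fin]
       linear_op_sum_any[OF linear_op_scale[OF linear_op_id] fin])

lemma linear_series_mult:
  assumes "linear_series A" "linear_series B" "summable_product A B"
  shows "linear_series (A \<odot> B)"
  unfolding linear_series_def series_mult_def
proof
  fix m
  show "linear_op (\<lambda>v. Sum_any (\<lambda>p. A p (B (m - p) v)))"
    by (rule linear_op_sum_any_family, rule linear_op_comp)
       (use assms in \<open>simp_all add: linear_series_def summable_product_def\<close>)
qed

text \<open>
  The Leibniz rule for the commutator with \<open>\<epsilon>\<^sub>k(n)\<close>, with the commutators \<open>A'\<close> and \<open>B'\<close> left arbitrary: for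
  exponents they are scalars, for vertex operators they are shifts of the series.
\<close>

lemma osc_series_mult:
  assumes lin: "linear_series A"
    and A: "\<And>p u. osc k n (A p u) - A p (osc k n u) = A' p u"
    and B: "\<And>q u. osc k n (B q u) - B q (osc k n u) = B' q u"
    and fin: "summable_product A B" "summable_product A' B" "summable_product A B'"
  shows "osc k n ((A \<odot> B) m v) - (A \<odot> B) m (osc k n v) = (A' \<odot> B) m v + (A \<odot> B') m v"
proof -
  have split: "osc k n (A p (B q v)) = (A' p (B q v) + A p (B' q v)) + A p (B q (osc k n v))" for p q
  proof -
    have "osc k n (B q v) = B' q v + B q (osc k n v)"
      using B[of q v] by (simp add: algebra_simps)
    moreover have "osc k n (A p (B q v)) = A' p (B q v) + A p (osc k n (B q v))"
      using A[of p "B q v"] by (simp add: algebra_simps)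
    moreover have "linear_op (A p)"
      using lin by (simp add: linear_series_def)
    ultimately show ?thesis
      by (simp add: module_hom.add add.assoc)
  qed
  have fin': "finite {p. A p (B (m - p) v) \<noteq> 0}" "finite {p. A p (B (m - p) (osc k n v)) \<noteq> 0}"
    "finite {p. A' p (B (m - p) v) \<noteq> 0}" "finite {p. A p (B' (m - p) v) \<noteq> 0}"
    using fin by (auto simp: summable_product_def)
  have "osc k n ((A \<odot> B) m v) = Sum_any (\<lambda>p. osc k n (A p (B (m - p) v)))"
    unfolding series_mult_def by (rule linear_op_sum_any[OF linear_op_osc fin'(1)])
  also have "\<dots> = Sum_any (\<lambda>p. A' p (B (m - p) v)) + Sum_any (\<lambda>p. A p (B' (m - p) v))
      + Sum_any (\<lambda>p. A p (B (m - p) (osc k n v)))"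
    unfolding split
    by (simp add: Sum_any.distrib finite_support_add fin')
  finally show ?thesis
    by (simp add: series_mult_def)
qed


lemma sum_any_shift: "Sum_any (\<lambda>p::int. f (p - n)) = Sum_any f"
proof (rule Sum_any.reindex_cong)
  show "bij (\<lambda>p. p + n)"
    by (rule bij_betw_byWitness[where f' = "\<lambda>p. p - n"]) auto
qed (simp add: fun_eq_iff)

lemma series_mult_shift_scale_left:
  assumes "summable_product A B"
  shows "summable_product (\<lambda>p u. c \<cdot> A (p - n) u) B"
    and "((\<lambda>p u. c \<cdot> A (p - n) u) \<odot> B) m v = c \<cdot> (A \<odot> B) (m - n) v"
proof -
  have fin: "finite {p. A p (B (m - n - p) v) \<noteq> 0}" for m v
    using assms by (simp add: summable_product_def)
  have "finite {p. A (p - n) (B (m - p) v) \<noteq> 0}" for m v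
  proof (rule finite_subset[OF _ finite_imageI[OF fin[of m v], of "\<lambda>p. p + n"]], rule subsetI)
    fix p
    assume "p \<in> {p. A (p - n) (B (m - p) v) \<noteq> 0}"
    then show "p \<in> (\<lambda>p. p + n) ` {p. A p (B (m - n - p) v) \<noteq> 0}"
      by (intro image_eqI[of _ _ "p - n"]) auto
  qed
  then show "summable_product (\<lambda>p u. c \<cdot> A (p - n) u) B"
    by (auto simp: summable_product_def)
  have "((\<lambda>p u. c \<cdot> A (p - n) u) \<odot> B) m v = Sum_any (\<lambda>p. c \<cdot> A (p - n) (B (m - n - (p - n)) v))"
    by (simp add: series_mult_def)
  also have "\<dots> = Sum_any (\<lambda>p. c \<cdot> A p (B (m - n - p) v))"
    by (rule sum_any_shift)
  also have "\<dots> = c \<cdot> (A \<odot> B) (m - n) v"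
    unfolding series_mult_def
    by (rule linear_op_sum_any[OF linear_op_scale[OF linear_op_id] fin, symmetric])
  finally show "((\<lambda>p u. c \<cdot> A (p - n) u) \<odot> B) m v = c \<cdot> (A \<odot> B) (m - n) v" .
qed

lemma series_mult_shift_scale_right:
  assumes "linear_series A" "summable_product A B"
  shows "summable_product A (\<lambda>q u. c \<cdot> B (q - n) u)"
    and "(A \<odot> (\<lambda>q u. c \<cdot> B (q - n) u)) m v = c \<cdot> (A \<odot> B) (m - n) v"
proof -
  have fin: "finite {p. A p (B (m - n - p) v) \<noteq> 0}" for m v
    using assms by (simp add: summable_product_def)
  have eq: "A p (c \<cdot> B (m - p - n) v) = c \<cdot> A p (B (m - n - p) v)" for p m v
    by (simp add: linear_series_scale[OF assms(1)] algebra_simps)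
  show "summable_product A (\<lambda>q u. c \<cdot> B (q - n) u)"
    using finite_support_linear_op[OF linear_op_scale[OF linear_op_id] fin]
    by (simp only: summable_product_def eq) simp
  show "(A \<odot> (\<lambda>q u. c \<cdot> B (q - n) u)) m v = c \<cdot> (A \<odot> B) (m - n) v"
    unfolding series_mult_def eq
    by (rule linear_op_sum_any[OF linear_op_scale[OF linear_op_id] fin, symmetric])
qed

lemma heis_weight_mult:
  assumes "linear_series A" "summable_product A B" "heis_weight c A" "heis_weight d B"
  shows "heis_weight (\<lambda>k n. c k n + d k n) (A \<odot> B)"
  unfolding heis_weight_def
proof (intro allI impI)
  fix k and n m :: int and v
  assume n: "odd n"
  have "osc k n ((A \<odot> B) m v) - (A \<odot> B) m (osc k n v) =
      ((\<lambda>p u. c k n \<cdot> A (p - n) u) \<odot> B) m v + (A \<odot> (\<lambda>q u. d k n \<cdot> B (q - n) u)) m v"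
    by (rule osc_series_mult)
       (use n assms series_mult_shift_scale_left(1)[OF assms(2)]
          series_mult_shift_scale_right(1)[OF assms(1,2)] in \<open>auto simp: heis_weight_def\<close>)
  then show "osc k n ((A \<odot> B) m v) - (A \<odot> B) m (osc k n v) = (c k n + d k n) \<cdot> (A \<odot> B) (m - n) v"
    by (simp add: series_mult_shift_scale_left(2)[OF assms(2)]
        series_mult_shift_scale_right(2)[OF assms(1,2)] fock.scale_left_distrib)
qed

lemma heis_weight_rescale:
  assumes "heis_weight c A" "a \<noteq> 0" "linear_series A"
  shows "heis_weight (\<lambda>k n. a powi n * c k n) (series_rescale a A)"
  unfolding heis_weight_def series_rescale_def
proof (intro allI impI)
  fix k and n m :: int and v
  assume n: "odd n"
  have "osc k n (a powi m \<cdot> A m v) - a powi m \<cdot> A m (osc k n v) = a powi m \<cdot> (osc k n (A m v) - A m (osc k n v))"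
    by (simp add: module_hom.scale[OF linear_op_osc] fock.scale_right_diff_distrib)
  also have "\<dots> = (a powi m * c k n) \<cdot> A (m - n) v"
    using assms(1) n by (simp add: heis_weight_def)
  also have "\<dots> = (a powi n * c k n) \<cdot> a powi (m - n) \<cdot> A (m - n) v"
    using assms(2) by (simp add: power_int_diff)
  finally show "osc k n (a powi m \<cdot> A m v) - a powi m \<cdot> A m (osc k n v)
      = (a powi n * c k n) \<cdot> a powi (m - n) \<cdot> A (m - n) v" .
qed

lemma linear_series_rescale: "linear_series A \<Longrightarrow> linear_series (series_rescale a A)"
  by (simp add: linear_series_def series_rescale_def linear_op_scale)

definition lower_truncated :: "'n op_series \<Rightarrow> bool" where
  "lower_truncated A \<longleftrightarrow> (\<forall>v. \<exists>K. \<forall>m<K. A m v = 0)"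

text \<open>
  The bound is found along the construction of \<open>v\<close> from a vacuum vector: the weight condition makes a
  creation operator \<open>\<epsilon>\<^sub>i(n)\<close> lower it by \<open>\<bar>n\<bar>\<close> at most.
\<close>

lemma lower_truncated_of_weight:
  assumes lin: "linear_series B" and weight: "heis_weight c B"
    and vac: "\<And>\<beta>. \<exists>K. \<forall>m<K. B m (vacuum \<beta>) = 0"
  shows "lower_truncated B"
  unfolding lower_truncated_def
proof
  fix v
  have lin': "linear_op (B m)" for m
    using lin by (simp add: linear_series_def)
  show "\<exists>K. \<forall>m<K. B m v = 0"
  proof (induction v rule: fock_induct)
    case (add u v)
    then obtain K L where K: "\<forall>m<K. B m u = 0" and L: "\<forall>m<L. B m v = 0" by blast
    show ?case
      by (rule exI[of _ "min K L"]) (use K L in \<open>simp add: module_hom.add[OF lin']\<close>)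
  next
    case (scale c v)
    then show ?case by (auto simp: module_hom.scale[OF lin'])
  next
    case (vacuum \<beta>)
    show ?case by (rule vac)
  next
    case (creation i n v)
    then obtain K where K: "\<And>m. m < K \<Longrightarrow> B m v = 0" by blast
    show ?case
    proof (intro exI[of _ "K + n"] allI impI)
      fix m assume m: "m < K + n"
      have "osc i n (B m v) - B m (osc i n v) = c i n \<cdot> B (m - n) v"
        using weight creation.hyps by (simp add: heis_weight_def)
      then show "B m (osc i n v) = 0"
        using m creation.hyps by (simp add: K module_hom.zero[OF linear_op_osc])
    qed
  qed
qed

text \<open>
  The sign \<open>\<sigma> = 1\<close> stands for series in \<open>z\<close>, as \<open>E\<^sub>-\<close>, and \<open>\<sigma> = -1\<close> for series in \<open>z\<^sup>-\<^sup>1\<close>, as \<open>E\<^sub>+\<close>. This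
  allows both to be treated together.
\<close>

definition supported :: "int \<Rightarrow> 'n op_series \<Rightarrow> int \<Rightarrow> bool" where
  "supported \<sigma> A l \<longleftrightarrow> (\<forall>m v. \<sigma> * m < l \<longrightarrow> A m v = 0)"

lemma finite_signed_interval:
  assumes "\<sigma> \<in> {1, - 1 :: int}"
  shows "finite {p. l \<le> \<sigma> * p \<and> \<sigma> * p \<le> m}"
  by (rule finite_subset[of _ "{- \<bar>l\<bar> - \<bar>m\<bar>..\<bar>l\<bar> + \<bar>m\<bar>}"]) (use assms in auto)

lemma summable_product_supported:
  assumes "\<sigma> \<in> {1, - 1}" "linear_series A" "supported \<sigma> A k" "supported \<sigma> B l"
  shows "summable_product A B"
  unfolding summable_product_def
proof (intro allI)
  fix m v
  have "A p (B (m - p) v) = 0" if "\<not> (k \<le> \<sigma> * p \<and> \<sigma> * p \<le> \<sigma> * m - l)" for p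
    using assms that linear_series_zero[OF assms(2), of p] by (auto simp: supported_def algebra_simps)
  then have "{p. A p (B (m - p) v) \<noteq> 0} \<subseteq> {p. k \<le> \<sigma> * p \<and> \<sigma> * p \<le> \<sigma> * m - l}"
    by blast
  then show "finite {p. A p (B (m - p) v) \<noteq> 0}"
    using finite_signed_interval[OF assms(1)] by (rule finite_subset)
qed

lemma supported_mult:
  assumes "linear_series A" "supported \<sigma> A k" "supported \<sigma> B l"
  shows "supported \<sigma> (A \<odot> B) (k + l)"
  unfolding supported_def series_mult_def
proof (intro allI impI)
  fix m v assume m: "\<sigma> * m < k + l"
  have "A p (B (m - p) v) = 0" for p
  proof (cases "\<sigma> * p < k")
    case True
    then show ?thesis using assms(2) by (simp add: supported_def)
  next
    case False
    with m have "\<sigma> * (m - p) < l" by (simp add: algebra_simps)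
    then have "B (m - p) v = 0" using assms(3) by (simp add: supported_def)
    then show ?thesis by (simp add: linear_series_zero[OF assms(1)])
  qed
  then show "Sum_any (\<lambda>p. A p (B (m - p) v)) = 0" by simp
qed

text \<open>
  This is what makes products with the creation part on the left meaningful: the right factor bounds the
  power of \<open>z\<close> from below on a given vector, and the left factor has only nonnegative powers.
\<close>

lemma summable_product_truncated:
  assumes "linear_series A" "supported 1 A 0" "lower_truncated B"
  shows "summable_product A B"
  unfolding summable_product_def
proof (intro allI)
  fix m v
  obtain K where K: "\<And>q. q < K \<Longrightarrow> B q v = 0"
    using assms(3) unfolding lower_truncated_def by blast
  have "A p (B (m - p) v) = 0" if "\<not> (0 \<le> p \<and> p \<le> m - K)" for p
    using assms that K[of "m - p"] linear_series_zero[OF assms(1), of p] by (auto simp: supported_def)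
  then have "{p. A p (B (m - p) v) \<noteq> 0} \<subseteq> {0..m - K}"
    by fastforce
  then show "finite {p. A p (B (m - p) v) \<noteq> 0}"
    by (rule finite_subset) simp
qed

lemma lower_truncated_mult:
  assumes "linear_series A" "supported 1 A 0" "lower_truncated B"
  shows "lower_truncated (A \<odot> B)"
  unfolding lower_truncated_def
proof
  fix v
  obtain K where K: "\<And>q. q < K \<Longrightarrow> B q v = 0"
    using assms(3) unfolding lower_truncated_def by blast
  have "A p (B (m - p) v) = 0" if "m < K" for p m
    using assms that K[of "m - p"]
    by (cases "p < 0") (auto simp: supported_def linear_series_zero[OF assms(1)])
  then show "\<exists>K. \<forall>m<K. (A \<odot> B) m v = 0"
    by (intro exI[of _ K]) (simp add: series_mult_def)
qed

section \<open>Exponentials of oscillators\<close>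

lemma linear_op_heis: "linear_op (heis \<alpha> n)"
proof (rule linear_opI)
  show "heis \<alpha> n (u + v) = heis \<alpha> n u + heis \<alpha> n v" for u v
    by (simp add: heis_def module_hom.add[OF linear_op_osc] fock.scale_right_distrib sum.distrib)
  show "heis \<alpha> n (c \<cdot> v) = c \<cdot> heis \<alpha> n v" for c v
    by (simp add: heis_def module_hom.scale[OF linear_op_osc] fock.scale_sum_right mult.commute)
qed

lemma osc_heis_commutator:
  assumes "odd m" "odd n"
  shows "osc k n (heis \<alpha> m v) - heis \<alpha> m (osc k n v) =
    (of_int n / 2 * of_int (poly_mapping.lookup \<alpha> k) * of_bool (m + n = 0)) \<cdot> v"
proof -
  have "osc k n (heis \<alpha> m v) - heis \<alpha> m (osc k n v) =
      (\<Sum>i\<in>UNIV. of_int (poly_mapping.lookup \<alpha> i) \<cdot> (osc k n (osc i m v) - osc i m (osc k n v)))"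
    by (simp add: heis_def module_hom.sum[OF linear_op_osc] module_hom.scale[OF linear_op_osc]
        fock.scale_right_diff_distrib sum_subtractf)
  also have "\<dots> = (\<Sum>i\<in>UNIV. if i = k then
      (of_int n / 2 * of_int (poly_mapping.lookup \<alpha> k) * of_bool (m + n = 0)) \<cdot> v else 0)"
    unfolding osc_commutator[OF assms(2,1)] by (intro sum.cong refl) (auto simp: add.commute)
  finally show ?thesis by simp
qed

text \<open>
  The modes whose exponential is \<open>E\<^sub>-\<close> (for \<open>\<sigma> = 1\<close>) or \<open>E\<^sub>+\<close> (for \<open>\<sigma> = -1\<close>): \<open>\<epsilon>\<^sub>i(n)\<close> comes with \<open>z\<^sup>-\<^sup>n\<close>, hence
  the opposite sign of \<open>n\<close>.
\<close>

definition half :: "int \<Rightarrow> int set" where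
  "half \<sigma> = {n. odd n \<and> \<sigma> * n < 0}"

text \<open>
  The exponent \<open>-2 \<Sum> \<alpha>(n)/n z\<^sup>-\<^sup>n\<close> indexed by the power \<open>m = -n\<close> of \<open>z\<close>.
\<close>

definition exponent :: "int \<Rightarrow> 'n::finite lattice \<Rightarrow> 'n op_series" where
  "exponent \<sigma> \<alpha> = (\<lambda>m v. if odd m \<and> 0 < \<sigma> * m then (2 / of_int m) \<cdot> heis \<alpha> (- m) v else 0)"

lemma exp_half_half: "exp_half (half \<sigma>) \<alpha> = series_exp (exponent \<sigma> \<alpha>)"
  by (simp add: exp_half_def exponent_def half_def cong: if_cong)

lemma E_minus_eq: "E_minus = exp_half (half 1)" and E_plus_eq: "E_plus = exp_half (half (- 1))"
  by (simp_all add: E_minus_def E_plus_def half_def)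

definition series_pow :: "'n op_series \<Rightarrow> nat \<Rightarrow> 'n op_series" where
  "series_pow A k = ((\<odot>) A ^^ k) (series_const 1)"

lemma series_pow_0: "series_pow A 0 m v = (if m = 0 then v else 0)"
  by (simp add: series_pow_def series_const_def)

lemma series_pow_Suc: "series_pow A (Suc k) = A \<odot> series_pow A k"
  by (simp add: series_pow_def)

lemma linear_series_exponent: "linear_series (exponent \<sigma> \<alpha>)"
  unfolding linear_series_def exponent_def
  by (intro allI linear_op_if linear_op_scale linear_op_heis linear_op_zero)

lemma supported_exponent: "supported \<sigma> (exponent \<sigma> \<alpha>) 1"
  by (auto simp: supported_def exponent_def)

text \<open>
  Exponentials of series without constant term in \<open>z\<close> or in \<open>z\<^sup>-\<^sup>1\<close>. The \<open>k\<close>-th power only involves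
  \<open>z\<^sup>m\<close> with \<open>\<bar>m\<bar> \<ge> k\<close>, so that every coefficient of the exponential is a finite sum.
\<close>

context
  fixes \<sigma> :: int and A :: "'n::finite op_series"
  assumes sign: "\<sigma> \<in> {1, - 1}" and lin: "linear_series A" and supp: "supported \<sigma> A 1"
begin

lemma series_pow_linear_supported: "linear_series (series_pow A k) \<and> supported \<sigma> (series_pow A k) (int k)"
proof (induction k)
  case 0
  then show ?case
    by (simp add: series_pow_0 linear_series_def supported_def linear_op_id linear_op_zero linear_op_if)
next
  case (Suc k)
  then show ?case
    unfolding series_pow_Suc
    using linear_series_mult[OF lin _ summable_product_supported[OF sign lin supp, of "series_pow A k" "int k"]]
      supported_mult[OF lin supp, of "series_pow A k" "int k"] by simp
qed

lemmas linear_series_pow = series_pow_linear_supported[THEN conjunct1]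
  and supported_pow = series_pow_linear_supported[THEN conjunct2]

lemma finite_exp_support: "finite {k. series_pow A k m v \<noteq> 0}"
proof (rule finite_subset)
  show "{k. series_pow A k m v \<noteq> 0} \<subseteq> {..nat (\<sigma> * m)}"
  proof
    fix k
    assume "k \<in> {k. series_pow A k m v \<noteq> 0}"
    then have "\<not> \<sigma> * m < int k"
      using supported_pow[of k] by (auto simp: supported_def)
    then show "k \<in> {..nat (\<sigma> * m)}" by simp
  qed
qed simp

lemma series_exp_eq: "series_exp A m v = Sum_any (\<lambda>k. (1 / fact k) \<cdot> series_pow A k m v)"
  by (simp add: series_exp_def series_pow_def)

lemma finite_exp_support': "finite {k. (1 / fact k) \<cdot> series_pow A k m v \<noteq> 0}"
  by (rule finite_subset[OF _ finite_exp_support[of m v]]) auto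

lemma linear_series_exp: "linear_series (series_exp A)"
  unfolding linear_series_def series_exp_eq
proof (intro allI linear_op_sum_any_family linear_op_scale)
  show "linear_op (series_pow A k m)" for k m
    using linear_series_pow by (simp add: linear_series_def)
qed (rule finite_exp_support')

lemma supported_exp: "supported \<sigma> (series_exp A) 0"
  unfolding supported_def series_exp_eq
proof (intro allI impI)
  fix m v assume "\<sigma> * m < 0"
  then have "series_pow A k m v = 0" for k
    using supported_pow[of k] by (simp add: supported_def)
  then show "Sum_any (\<lambda>k. (1 / fact k) \<cdot> series_pow A k m v) = 0" by simp
qed

lemma series_exp_0: "series_exp A 0 v = v"
proof -
  have "(1 / fact k) \<cdot> series_pow A k 0 v = (if k = 0 then v else 0)" for k
    using supported_pow[of k] by (auto simp: supported_def series_pow_0)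
  then show ?thesis
    by (simp add: series_exp_eq)
qed

text \<open>
  If the commutator of \<open>x = \<epsilon>\<^sub>k(n)\<close> with \<open>A\<close> is the scalar series \<open>d z\<^sup>n\<close>, then \<open>[x, A\<^sup>k] = k d z\<^sup>n A\<^bsup>k-1\<^esup>\<close>, and
  summing over \<open>k\<close> gives \<open>[x, exp A] = d z\<^sup>n exp A\<close>.
\<close>

lemma heis_weight_exp:
  assumes A: "\<And>k n p v. odd n \<Longrightarrow> osc k n (A p v) - A p (osc k n v) = (d k n * of_bool (p = n)) \<cdot> v"
  shows "heis_weight d (series_exp A)"
  unfolding heis_weight_def
proof (intro allI impI)
  fix j and n m :: int and v
  assume n: "odd n"
  \<comment> \<open>the scalar series \<open>d z\<^sup>n\<close>\<close>
  define S :: "'n op_series" where "S = (\<lambda>p v. (d j n * of_bool (p = n)) \<cdot> v)"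
  have S: "summable_product S B" "(S \<odot> B) m v = d j n \<cdot> B (m - n) v" for B m v
  proof -
    have eq: "S p (B (m - p) v) = (if p = n then d j n \<cdot> B (m - n) v else 0)" for m v p
      by (simp add: S_def)
    show "summable_product S B"
      unfolding summable_product_def eq
      by (intro allI, rule finite_subset[of _ "{n}"]) auto
    show "(S \<odot> B) m v = d j n \<cdot> B (m - n) v"
      by (simp add: series_mult_def eq)
  qed
  have step: "osc j n (series_pow A (Suc k) m v) - series_pow A (Suc k) m (osc j n v) =
      (of_nat (Suc k) * d j n) \<cdot> series_pow A k (m - n) v" for k m v
  proof (induction k arbitrary: m v)
    case 0
    have "series_pow A (Suc 0) m v = A m v" for m v
    proof -
      have "A p (series_pow A 0 (m - p) v) = (if p = m then A m v else 0)" for p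
        by (simp add: series_pow_0 linear_series_zero[OF lin])
      then show ?thesis by (simp add: series_pow_Suc series_mult_def)
    qed
    then show ?case
      using A[OF n] by (simp add: series_pow_0)
  next
    case (Suc k)
    define P where "P = series_pow A (Suc k)"
    define Q where "Q = series_pow A k"
    have sumQ: "summable_product A Q" and sumP: "summable_product A P"
      unfolding P_def Q_def by (rule summable_product_supported[OF sign lin supp supported_pow])+
    have "osc j n ((A \<odot> P) m v) - (A \<odot> P) m (osc j n v) =
        (S \<odot> P) m v + (A \<odot> (\<lambda>q u. (of_nat (Suc k) * d j n) \<cdot> Q (q - n) u)) m v"
      by (rule osc_series_mult[OF lin _ _ sumP S(1) series_mult_shift_scale_right(1)[OF lin sumQ]])
         (use A[OF n] Suc.IH in \<open>simp_all add: S_def P_def Q_def\<close>)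
    also have "\<dots> = d j n \<cdot> P (m - n) v + (of_nat (Suc k) * d j n) \<cdot> P (m - n) v"
      unfolding S series_mult_shift_scale_right(2)[OF lin sumQ]
      by (simp add: P_def Q_def series_pow_Suc)
    also have "\<dots> = (of_nat (Suc (Suc k)) * d j n) \<cdot> P (m - n) v"
      unfolding fock.scale_left_distrib[symmetric] by (simp add: algebra_simps)
    finally show ?case
      unfolding P_def series_pow_Suc[of A "Suc k"] .
  qed
  have bound: "series_pow A k p u = 0" if "nat \<bar>p\<bar> < k" for k p u
    using supported_pow[of k] sign that by (auto simp: supported_def)
  \<comment> \<open>a common bound for the powers that contribute to the coefficients \<open>m\<close> and \<open>m - n\<close>\<close>
  define K where "K = Suc (nat \<bar>m\<bar> + nat \<bar>m - n\<bar>)"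
  have exp: "series_exp A p u = (\<Sum>k\<le>L. (1 / fact k) \<cdot> series_pow A k p u)" if "nat \<bar>p\<bar> \<le> L" for p u L
    unfolding series_exp_eq
  proof (rule Sum_any.expand_superset)
    have "series_pow A k p u = 0" if "\<not> k \<le> L" for k
      using bound that \<open>nat \<bar>p\<bar> \<le> L\<close> by simp
    then show "{k. (1 / fact k) \<cdot> series_pow A k p u \<noteq> 0} \<subseteq> {..L}" by auto
  qed simp
  have "osc j n (series_exp A m v) - series_exp A m (osc j n v) =
      (\<Sum>k\<le>Suc K. (1 / fact k) \<cdot> (osc j n (series_pow A k m v) - series_pow A k m (osc j n v)))"
    by (subst (1 2) exp[of m "Suc K"])
       (simp_all only: module_hom.sum[OF linear_op_osc] module_hom.scale[OF linear_op_osc]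
        fock.scale_right_diff_distrib sum_subtractf, simp_all add: K_def)
  also have "\<dots> = (\<Sum>k\<le>K. (1 / fact (Suc k)) \<cdot> (of_nat (Suc k) * d j n) \<cdot> series_pow A k (m - n) v)"
    by (subst sum.atMost_Suc_shift, subst step)
       (simp add: series_pow_0 module_hom.zero[OF linear_op_osc])
  also have "\<dots> = (\<Sum>k\<le>K. d j n \<cdot> (1 / fact k) \<cdot> series_pow A k (m - n) v)"
    by (intro sum.cong refl) (simp add: field_simps del: of_nat_Suc)
  also have "\<dots> = d j n \<cdot> series_exp A (m - n) v"
  proof -
    have "nat \<bar>m - n\<bar> \<le> K" by (simp add: K_def)
    from exp[OF this] show ?thesis by (simp only: fock.scale_sum_right)
  qed
  finally show "osc j n (series_exp A m v) - series_exp A m (osc j n v) = d j n \<cdot> series_exp A (m - n) v" .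
qed

end

lemma linear_E: "linear_series (E_minus \<alpha>)" "linear_series (E_plus \<alpha>)"
  and supported_E: "supported 1 (E_minus \<alpha>) 0" "supported (- 1) (E_plus \<alpha>) 0"
  and E_0: "E_minus \<alpha> 0 v = v" "E_plus \<alpha> 0 v = v"
  unfolding E_minus_eq E_plus_eq exp_half_half
  using linear_series_exp[OF _ linear_series_exponent supported_exponent, of 1 \<alpha>]
    linear_series_exp[OF _ linear_series_exponent supported_exponent, of "- 1" \<alpha>]
    supported_exp[OF _ linear_series_exponent supported_exponent, of 1 \<alpha>]
    supported_exp[OF _ linear_series_exponent supported_exponent, of "- 1" \<alpha>]
    series_exp_0[OF _ linear_series_exponent supported_exponent, of 1 \<alpha> v]
    series_exp_0[OF _ linear_series_exponent supported_exponent, of "- 1" \<alpha> v]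
  by simp_all

lemma osc_exponent:
  assumes "odd n"
  shows "osc k n (exponent \<sigma> \<alpha> p v) - exponent \<sigma> \<alpha> p (osc k n v) =
    (of_int (poly_mapping.lookup \<alpha> k) * of_bool (0 < \<sigma> * n) * of_bool (p = n)) \<cdot> v"
proof (cases "odd p \<and> 0 < \<sigma> * p")
  case True
  then have "osc k n (exponent \<sigma> \<alpha> p v) - exponent \<sigma> \<alpha> p (osc k n v) =
      (2 / of_int p) \<cdot> (osc k n (heis \<alpha> (- p) v) - heis \<alpha> (- p) (osc k n v))"
    by (simp add: exponent_def module_hom.scale[OF linear_op_osc] fock.scale_right_diff_distrib)
  also have "\<dots> = (of_int (poly_mapping.lookup \<alpha> k) * of_bool (0 < \<sigma> * n) * of_bool (p = n)) \<cdot> v"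
    using True assms by (subst osc_heis_commutator) auto
  finally show ?thesis .
next
  case False
  then show ?thesis
    using assms by (auto simp: exponent_def module_hom.zero[OF linear_op_osc])
qed

lemma heis_weight_E:
  "heis_weight (\<lambda>k n. of_int (poly_mapping.lookup \<alpha> k) * of_bool (0 < n)) (E_minus \<alpha>)"
  "heis_weight (\<lambda>k n. of_int (poly_mapping.lookup \<alpha> k) * of_bool (n < 0)) (E_plus \<alpha>)"
  unfolding E_minus_eq E_plus_eq exp_half_half
  using heis_weight_exp[OF _ linear_series_exponent supported_exponent osc_exponent, of 1 \<alpha>]
    heis_weight_exp[OF _ linear_series_exponent supported_exponent osc_exponent, of "- 1" \<alpha>]
  by simp_all

section \<open>Matrix elements of the exponentials\<close>

text \<open>
  The exponent of \<open>E\<^sub>+\<close> when every \<open>\<alpha>(r)\<close>, \<open>r > 0\<close>, acts as the scalar \<open>\<theta>\<close>: the series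
  \<open>-2 \<theta> \<Sum> x\<^sup>p / p\<close> over odd \<open>p\<close>, which is \<open>\<theta> log ((1 - x) / (1 + x))\<close>.
\<close>

definition pair_exponent :: "complex \<Rightarrow> complex fps" where
  "pair_exponent \<theta> = Abs_fps (\<lambda>p. if odd p then - 2 * \<theta> / of_nat p else 0)"

text \<open>
  The generating series \<open>\<Sum> u\<^sub>n w\<^sup>n\<close> is a joint eigenvector of the annihilation operators, with
  eigenvalue \<open>\<theta> w\<^sup>r\<close> for \<open>\<alpha>(r)\<close>. The exponent of \<open>E\<^sub>+(\<alpha>,z)\<close> therefore acts on it as the scalar series
  \<open>pair_exponent \<theta>\<close> in \<open>x = w/z\<close>, and \<open>E\<^sub>+(\<alpha>,z)\<close> as the exponential of this scalar.
\<close>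

lemma E_plus_eigen:
  fixes u :: "int \<Rightarrow> 'n::finite fock"
  assumes u: "\<And>n r. odd r \<Longrightarrow> r > 0 \<Longrightarrow> heis \<alpha> r (u n) = \<theta> \<cdot> u (n - r)"
  shows "E_plus \<alpha> (- int p) (u n) = fps_nth (fps_exp 1 oo pair_exponent \<theta>) p \<cdot> u (n - int p)"
proof -
  define A where "A = exponent (- 1) \<alpha>"
  have sign: "- 1 \<in> {1, - 1 :: int}" and lin: "linear_series A" and supp: "supported (- 1) A 1"
    unfolding A_def by (simp, rule linear_series_exponent, rule supported_exponent)
  note supp_pow = supported_pow[OF sign lin supp]
  have A: "A (- int q) (u n) = fps_nth (pair_exponent \<theta>) q \<cdot> u (n - int q)" for q n
    using u[of "int q" n] by (auto simp: A_def exponent_def pair_exponent_def)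
  have pow: "series_pow A k (- int p) (u n) = fps_nth (pair_exponent \<theta> ^ k) p \<cdot> u (n - int p)" for k p n
  proof (induction k arbitrary: p n)
    case 0
    then show ?case by (simp add: series_pow_0)
  next
    case (Suc k)
    have zero: "A q (series_pow A k (- int p - q) (u n)) = 0" if "q \<notin> (\<lambda>i. - int i) ` {0..p}" for q
    proof (cases "q > 0")
      case True
      then show ?thesis using supp by (simp add: supported_def)
    next
      case False
      then have "q = - int (nat (- q))" by simp
      with that have "\<not> nat (- q) \<le> p"
        by (metis atLeastAtMost_iff image_eqI zero_le)
      then have "- 1 * (- int p - q) < int k"
        using False by simp
      then have "series_pow A k (- int p - q) (u n) = 0"
        using supp_pow[of k] unfolding supported_def by blast
      then show ?thesis by (simp add: linear_series_zero[OF lin])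
    qed
    have "series_pow A (Suc k) (- int p) (u n) =
        (\<Sum>q\<in>(\<lambda>i. - int i) ` {0..p}. A q (series_pow A k (- int p - q) (u n)))"
      unfolding series_pow_Suc series_mult_def
      by (rule Sum_any.expand_superset) (use zero in auto)
    also have "\<dots> = (\<Sum>i=0..p. A (- int i) (series_pow A k (- int p - (- int i)) (u n)))"
      by (subst sum.reindex) (auto simp: inj_on_def)
    also have "\<dots> = (\<Sum>i=0..p. (fps_nth (pair_exponent \<theta>) i * fps_nth (pair_exponent \<theta> ^ k) (p - i)) \<cdot> u (n - int p))"
    proof (rule sum.cong[OF refl])
      fix i assume i: "i \<in> {0..p}"
      then have eq: "- int p - (- int i) = - int (p - i)" and eq': "n - int (p - i) - int i = n - int p"
        by auto
      show "A (- int i) (series_pow A k (- int p - (- int i)) (u n)) =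
          (fps_nth (pair_exponent \<theta>) i * fps_nth (pair_exponent \<theta> ^ k) (p - i)) \<cdot> u (n - int p)"
        unfolding eq Suc.IH linear_series_scale[OF lin] A eq' by (simp add: mult.commute)
    qed
    finally show ?case
      by (simp add: fps_mult_nth fock.scale_sum_left)
  qed
  have zero: "(1 / fact k) \<cdot> series_pow A k (- int p) (u n) = 0" if "k \<notin> {0..p}" for k
    using supp_pow[of k] that by (simp add: supported_def)
  have "E_plus \<alpha> (- int p) (u n) = Sum_any (\<lambda>k. (1 / fact k) \<cdot> series_pow A k (- int p) (u n))"
    unfolding E_plus_eq exp_half_half A_def[symmetric] by (rule series_exp_eq[OF sign lin supp])
  also have "\<dots> = (\<Sum>k=0..p. (1 / fact k) \<cdot> series_pow A k (- int p) (u n))"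
    by (rule Sum_any.expand_superset) (use zero in blast)+
  also have "\<dots> = fps_nth (fps_exp 1 oo pair_exponent \<theta>) p \<cdot> u (n - int p)"
    by (simp add: pow fps_compose_nth fock.scale_sum_left)
  finally show ?thesis .
qed

lemma exp_pair_exponent_0: "fps_nth (fps_exp 1 oo pair_exponent 0) p = of_bool (p = 0)"
proof -
  have "pair_exponent 0 = 0"
    by (simp add: fps_eq_iff pair_exponent_def)
  then show ?thesis
    by (cases p) (simp_all add: fps_compose_nth)
qed

text \<open>
  The exponential \<open>f\<close> of \<open>log ((1 - x) / (1 + x))\<close> is determined by \<open>(1 - x\<^sup>2) f' = -2 f\<close> and
  \<open>f(0) = 1\<close>; the coefficients below are those of \<open>(1 - x) / (1 + x)\<close>.
\<close>

lemma exp_pair_exponent_1: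
  "fps_nth (fps_exp 1 oo pair_exponent 1) p = (if p = 0 then 1 else 2 * (- 1) ^ p)"
proof -
  define h where "h = pair_exponent 1"
  define f where "f = fps_exp 1 oo h"
  have h0: "fps_nth h 0 = 0"
    by (simp add: h_def pair_exponent_def)
  have "fps_deriv f = f * fps_deriv h"
    unfolding f_def using fps_compose_deriv[OF h0, of "fps_exp 1"] by simp
  moreover have "(1 - fps_X ^ 2) * fps_deriv h = fps_const (- 2)"
  proof (rule fps_ext)
    fix n :: nat
    have h': "fps_nth (fps_deriv h) n = (if even n then - 2 else 0)" for n
      by (simp add: h_def pair_exponent_def del: of_nat_Suc)
    show "fps_nth ((1 - fps_X ^ 2) * fps_deriv h) n = fps_nth (fps_const (- 2)) n"
      unfolding left_diff_distrib mult_1 fps_sub_nth fps_X_power_mult_nth h' fps_nth_fps_const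
      by (cases n; cases "n - 1") (auto split: if_splits)
  qed
  ultimately have ode: "(1 - fps_X ^ 2) * fps_deriv f = fps_const (- 2) * f"
    by (metis mult.assoc mult.commute)
  have rec: "of_nat (Suc n) * fps_nth f (Suc n) =
      (if n < 2 then 0 else of_nat (n - 1) * fps_nth f (n - 1)) - 2 * fps_nth f n" for n
  proof -
    have "fps_nth (fps_deriv f) n - (if n < 2 then 0 else fps_nth (fps_deriv f) (n - 2)) = - 2 * fps_nth f n"
      using arg_cong[OF ode, of "\<lambda>g. fps_nth g n"]
      by (simp only: left_diff_distrib mult_1 fps_sub_nth fps_X_power_mult_nth fps_mult_left_const_nth)
    then show ?thesis
      by (cases "n < 2") (auto simp: algebra_simps eval_nat_numeral Suc_diff_Suc simp del: of_nat_Suc)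
  qed
  have "fps_nth f p = (if p = 0 then 1 else 2 * (- 1) ^ p)"
  proof (induction p rule: less_induct)
    case (less p)
    show ?case
    proof (cases p)
      case 0
      then show ?thesis by (simp add: f_def)
    next
      case (Suc n)
      have "of_nat p * fps_nth f p = of_nat p * (2 * (- 1) ^ p)"
      proof (cases "n < 2")
        case True
        then consider "n = 0" | "n = 1" by linarith
        then show ?thesis
          using rec[of n] less.IH[of n] Suc by cases (simp_all)
      next
        case False
        then obtain l where l: "n = Suc (Suc l)"
          by (metis add_2_eq_Suc le_Suc_ex not_less)
        show ?thesis
          using rec[of n] less.IH[of n] less.IH[of "Suc l"] unfolding Suc l
          by (simp add: algebra_simps)
      qed
      moreover have "of_nat p \<noteq> (0 :: complex)"
        using Suc by (simp del: of_nat_Suc)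
      ultimately have "fps_nth f p = 2 * (- 1) ^ p"
        by (metis mult_left_cancel)
      then show ?thesis
        using Suc by simp
    qed
  qed
  then show ?thesis by (simp add: f_def h_def)
qed

lemma heis_vacuum: "r > 0 \<Longrightarrow> heis \<alpha> r (vacuum \<beta>) = 0"
  by (simp add: heis_def osc_vacuum)

lemma heis_eps_vec: "heis (eps_vec i) n v = osc i n v"
proof -
  have "heis (eps_vec i) n v = (\<Sum>j\<in>UNIV. if j = i then osc i n v else 0)"
    unfolding heis_def by (intro sum.cong refl) (auto simp: eps_vec_def lookup_single when_def)
  then show ?thesis by simp
qed

lemma E_plus_vacuum: "E_plus \<alpha> m (vacuum \<beta>) = (if m = 0 then vacuum \<beta> else 0)"
proof (cases "m > 0")
  case True
  then show ?thesis using supported_E(2)[of \<alpha>] by (simp add: supported_def)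
next
  case False
  then have "m = - int (nat (- m))" by simp
  moreover have "E_plus \<alpha> (- int p) (vacuum \<beta>) = of_bool (p = 0) \<cdot> vacuum \<beta>" for p
    using E_plus_eigen[of \<alpha> "\<lambda>_. vacuum \<beta>" 0 p 0] by (simp add: heis_vacuum exp_pair_exponent_0)
  ultimately have "E_plus \<alpha> m (vacuum \<beta>) = of_bool (nat (- m) = 0) \<cdot> vacuum \<beta>"
    by metis
  then show ?thesis
    using False by simp
qed

text \<open>
  All terms of \<open>E\<^sub>-\<close> except the identity end with a creation operator, whose image has no vacuum component.
\<close>

lemma vac_coeff_E_minus: "vac_coeff \<beta> (E_minus \<alpha> m v) = (if m = 0 then vac_coeff \<beta> v else 0)"
proof (cases "m = 0")
  case True
  then show ?thesis by (simp add: E_0)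
next
  case False
  define A where "A = exponent 1 \<alpha>"
  have sign: "1 \<in> {1, - 1 :: int}" and lin: "linear_series A" and supp: "supported 1 A 1"
    unfolding A_def by (simp, rule linear_series_exponent, rule supported_exponent)
  have "vac_coeff \<beta> (heis \<alpha> n w) = 0" if "n < 0" for n w
  proof -
    have "vac_coeff \<beta> (sum f S) = (\<Sum>i\<in>S. vac_coeff \<beta> (f i))" for f and S :: "'a set"
      by (induction S rule: infinite_finite_induct) (simp_all add: vac_coeff_add)
    then show ?thesis
      using that by (simp add: heis_def vac_coeff_scale vac_coeff_osc_creation)
  qed
  then have A: "vac_coeff \<beta> (A p w) = 0" for p w
    by (simp add: A_def exponent_def vac_coeff_scale)
  have pow: "vac_coeff \<beta> (series_pow A k m v) = 0" for k
  proof (cases k)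
    case 0
    then show ?thesis using False by (simp add: series_pow_0)
  next
    case (Suc l)
    have "summable_product A (series_pow A l)"
      by (rule summable_product_supported[OF sign lin supp supported_pow[OF sign lin supp]])
    then show ?thesis
      unfolding Suc series_pow_Suc series_mult_def summable_product_def
      by (subst vac_coeff_sum_any) (auto simp: A)
  qed
  have "vac_coeff \<beta> (E_minus \<alpha> m v) = 0"
    unfolding E_minus_eq exp_half_half A_def[symmetric] series_exp_eq[OF sign lin supp]
    by (subst vac_coeff_sum_any[OF finite_exp_support'[OF sign lin supp]]) (simp add: vac_coeff_scale pow)
  with False show ?thesis by simp
qed

lemma vac_coeff_series_mult:
  assumes "summable_product A B"
    and "\<And>p w. vac_coeff \<beta> (A p w) = (if p = 0 then vac_coeff \<beta> w else 0)"
  shows "vac_coeff \<beta> ((A \<odot> B) m v) = vac_coeff \<beta> (B m v)"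
proof -
  have "finite {p. A p (B (m - p) v) \<noteq> 0}"
    using assms(1) by (simp add: summable_product_def)
  then have "vac_coeff \<beta> ((A \<odot> B) m v) = Sum_any (\<lambda>p. if p = 0 then vac_coeff \<beta> (B (m - p) v) else 0)"
    unfolding series_mult_def by (subst vac_coeff_sum_any) (simp_all add: assms(2))
  then show ?thesis by simp
qed

lemma series_mult_vacuum:
  assumes "linear_series A" and "\<And>q. B q w = (if q = 0 then w' else 0)"
  shows "(A \<odot> B) m w = A m w'"
proof -
  have "A p (B (m - p) w) = (if p = m then A m w' else 0)" for p
    by (simp add: assms(2) linear_series_zero[OF assms(1)])
  then show ?thesis by (simp add: series_mult_def)
qed

lemma lower_truncated_E_plus: "lower_truncated (E_plus \<alpha>)"
  by (rule lower_truncated_of_weight[OF linear_E(2) heis_weight_E(2)])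
     (auto simp: E_plus_vacuum intro!: exI[of _ 0])

lemma heis_weight_cong:
  "heis_weight c A \<Longrightarrow> (\<And>k n. odd n \<Longrightarrow> c k n = d k n) \<Longrightarrow> heis_weight d A"
  by (simp add: heis_weight_def)

section \<open>The fermion fields\<close>

definition vertex :: "'n::finite \<Rightarrow> 'n op_series" where
  "vertex i = E_minus (eps_vec i) \<odot> E_plus (eps_vec i)"

text \<open>
  The field \<open>\<psi>\<^sub>i(z) = e\<^sup>\<epsilon>\<^sub>i E\<^sub>-(\<epsilon>\<^sub>i,z) E\<^sub>+(\<epsilon>\<^sub>i,z)\<close>; the mode \<open>fermion i m\<close> is the coefficient of \<open>z\<^sup>m\<close>.
\<close>

definition fermion :: "'n::{finite,linorder} \<Rightarrow> 'n op_series" where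
  "fermion i = (\<lambda>m v. group_op (mod2 (eps_vec i)) (vertex i m v))"

lemma summable_vertex: "summable_product (E_minus \<alpha>) (E_plus \<beta>)"
  by (rule summable_product_truncated[OF linear_E(1) supported_E(1) lower_truncated_E_plus])

lemma linear_series_vertex: "linear_series (vertex i)"
  unfolding vertex_def by (rule linear_series_mult[OF linear_E summable_vertex])

lemma lower_truncated_vertex: "lower_truncated (vertex i)"
  unfolding vertex_def by (rule lower_truncated_mult[OF linear_E(1) supported_E(1) lower_truncated_E_plus])

text \<open>
  \<open>E\<^sub>-\<close> contributes the weights with \<open>n > 0\<close> and \<open>E\<^sub>+\<close> those with \<open>n < 0\<close>.
\<close>

lemma heis_weight_vertex: "heis_weight (\<lambda>k n. of_bool (k = i)) (vertex i)"
  unfolding vertex_def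
  by (rule heis_weight_cong[OF heis_weight_mult[OF linear_E(1) summable_vertex heis_weight_E]])
     (auto simp: eps_vec_def lookup_single when_def not_less le_less)

lemma linear_series_fermion: "linear_series (fermion i)"
  unfolding fermion_def linear_series_def
  by (intro allI linear_op_comp[OF linear_op_group_op])
     (use linear_series_vertex[of i] in \<open>simp add: linear_series_def\<close>)

lemma lower_truncated_fermion: "lower_truncated (fermion i)"
  unfolding lower_truncated_def
proof
  fix v
  obtain K where "\<forall>m<K. vertex i m v = 0"
    using lower_truncated_vertex unfolding lower_truncated_def by blast
  then have "\<forall>m<K. fermion i m v = 0"
    by (simp add: fermion_def module_hom.zero[OF linear_op_group_op])
  then show "\<exists>K. \<forall>m<K. fermion i m v = 0" ..
qed

lemma osc_fermion:
  assumes "odd n"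
  shows "osc k n (fermion i m v) = fermion i m (osc k n v) + of_bool (k = i) \<cdot> fermion i (m - n) v"
proof -
  have "osc k n (vertex i m v) = vertex i m (osc k n v) + of_bool (k = i) \<cdot> vertex i (m - n) v"
    using heis_weight_vertex assms unfolding heis_weight_def by (metis diff_add_cancel add.commute)
  then show ?thesis
    by (simp add: fermion_def osc_group_op module_hom.add[OF linear_op_group_op] module_hom.scale[OF linear_op_group_op]
        del: of_bool_eq_iff)
qed

section \<open>The Clifford relations\<close>

lemma mod2_add: "mod2 (\<alpha> + \<beta>) = mod2 \<alpha> + mod2 \<beta>"
  by (simp add: plus_lattice_mod2.abs_eq)

lemma mod2_double: "mod2 \<alpha> + mod2 \<alpha> = 0"
  unfolding mod2_add[symmetric] zero_lattice_mod2_def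
  by (auto simp: lattice_mod2.abs_eq_iff)

lemma mod2_diff: "mod2 (\<alpha> - \<beta>) = mod2 \<alpha> + mod2 \<beta>"
proof -
  have "mod2 (\<alpha> - \<beta>) + mod2 \<beta> = mod2 \<alpha>"
    by (simp flip: mod2_add)
  then have "mod2 (\<alpha> - \<beta>) + (mod2 \<beta> + mod2 \<beta>) = mod2 \<alpha> + mod2 \<beta>"
    by (simp add: add.assoc)
  then show ?thesis
    by (simp add: mod2_double)
qed

lemma cocycle_mod2_mod2: "cocycle_mod2 (mod2 \<alpha>) (mod2 \<beta>) = cocycle \<alpha> \<beta>"
  by (simp add: cocycle_mod2.abs_eq)

lemma group_op_zero:
  fixes v :: "'n::{finite,linorder} fock"
  shows "group_op 0 v = v"
proof (rule poly_mapping_eqI)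
  fix \<beta> :: "'n lattice_mod2"
  have "cocycle_mod2 0 \<beta> * cocycle_mod2 0 \<beta> = cocycle_mod2 0 \<beta>" "cocycle_mod2 0 \<beta> * cocycle_mod2 0 \<beta> = 1"
    by (simp flip: cocycle_mod2_add_left, transfer, rule cocycle_square)
  then show "poly_mapping.lookup (group_op 0 v) \<beta> = poly_mapping.lookup v \<beta>"
    by (simp add: lookup_group_op sym_const_def)
qed

lemma group_op_eps_eps:
  "group_op (mod2 (eps_vec i)) (group_op (mod2 (eps_vec j)) v) =
     cocycle (eps_vec i) (eps_vec j) \<cdot> group_op (mod2 (eps_vec i - eps_vec j)) v"
  by (simp add: group_op_group_op cocycle_mod2_mod2 mod2_diff)

lemma group_op_eps_square: "group_op (mod2 (eps_vec i)) (group_op (mod2 (eps_vec i)) v) = v"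
  by (simp add: group_op_group_op cocycle_mod2_mod2 mod2_double group_op_zero cocycle_eps_vec)

lemma group_op_eps_anticommute:
  assumes "i \<noteq> j"
  shows "group_op (mod2 (eps_vec i)) (group_op (mod2 (eps_vec j)) v) +
    group_op (mod2 (eps_vec j)) (group_op (mod2 (eps_vec i)) v) = 0"
  using assms
  by (auto simp: group_op_group_op cocycle_mod2_mod2 cocycle_eps_vec add.commute[of "mod2 (eps_vec j)"]
      simp flip: fock.scale_left_distrib)

lemma lookup_eps_vec: "poly_mapping.lookup (eps_vec j) k = of_bool (k = j)"
  by (simp add: eps_vec_def lookup_single when_def)

lemma vertex_vacuum: "vertex i m (vacuum \<beta>) = E_minus (eps_vec i) m (vacuum \<beta>)"
  unfolding vertex_def by (rule series_mult_vacuum) (rule linear_E, rule E_plus_vacuum)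

text \<open>
  The coefficient of \<open>z\<^sup>m w\<^sup>n\<close> in \<open>\<delta>\<^sub>i\<^sub>j (1 - w/z) / (1 + w/z)\<close>, expanded in powers of \<open>w/z\<close>. The factor
  \<open>1 + sgn n\<close> is 0, 1 or 2 and restricts to \<open>n \<ge> 0\<close>; in this form
  differences of contractions become differences of signs.
\<close>

definition contraction :: "'n \<Rightarrow> 'n \<Rightarrow> int \<Rightarrow> int \<Rightarrow> complex" where
  "contraction i j m n = of_bool (i = j \<and> m + n = 0) * ((- 1) powi n * (1 + of_int (sgn n)))"

text \<open>
  On a vacuum vector \<open>\<psi>\<^sub>j(w)\<close> reduces to \<open>e\<^sup>\<epsilon>\<^sub>j E\<^sub>-(\<epsilon>\<^sub>j,w)\<close>, which gives a joint eigenvector of the annihilation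
  operators, and only \<open>E\<^sub>+(\<epsilon>\<^sub>i,z)\<close> of \<open>\<psi>\<^sub>i(z)\<close> affects the vacuum component. So the matrix element is the
  scalar by which \<open>E\<^sub>+\<close> acts, times the matrix element of the group elements.
\<close>

lemma vac_coeff_fermion_pair:
  "vac_coeff \<gamma> (fermion i m (fermion j n (vacuum \<beta>))) =
     (if i = j then contraction i j m n * of_bool (\<gamma> = \<beta>)
      else of_bool (m = 0 \<and> n = 0) * vac_coeff \<gamma> (group_op (mod2 (eps_vec i)) (group_op (mod2 (eps_vec j)) (vacuum \<beta>))))"
proof -
  let ?g = "\<lambda>i. group_op (mod2 (eps_vec i)) :: 'a fock \<Rightarrow> 'a fock"
  define u where "u = (\<lambda>q. ?g j (E_minus (eps_vec j) q (vacuum \<beta>)))"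
  have u: "fermion j q (vacuum \<beta>) = u q" for q
    by (simp add: fermion_def u_def vertex_vacuum)
  have vac_u: "vac_coeff \<delta> (u q) = of_bool (q = 0) * vac_coeff \<delta> (?g j (vacuum \<beta>))" for \<delta> q
    by (simp add: u_def vac_coeff_group_op vac_coeff_E_minus)
  have heis_u: "heis (eps_vec i) r (u q) = of_bool (i = j) \<cdot> u (q - r)" if "odd r" "r > 0" for q r
  proof -
    have "osc i r (E_minus (eps_vec j) q (vacuum \<beta>)) = of_bool (i = j) \<cdot> E_minus (eps_vec j) (q - r) (vacuum \<beta>)"
      using heis_weight_E(1)[of "eps_vec j", unfolded heis_weight_def, rule_format, OF that(1), of i q "vacuum \<beta>"] that(2)
      by (simp add: osc_vacuum linear_series_zero[OF linear_E(1)] lookup_eps_vec)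
    then show ?thesis
      unfolding heis_eps_vec u_def osc_group_op by (simp add: module_hom.scale[OF linear_op_group_op] del: of_bool_eq_iff)
  qed
  have "vac_coeff \<gamma> (fermion i m (u n)) = cocycle_mod2 (mod2 (eps_vec i)) (\<gamma> - mod2 (eps_vec i)) *
      vac_coeff (\<gamma> - mod2 (eps_vec i)) (E_plus (eps_vec i) m (u n))"
    by (simp add: fermion_def vac_coeff_group_op vertex_def vac_coeff_series_mult[OF summable_vertex vac_coeff_E_minus])
  also have "\<dots> = vac_coeff \<gamma> (?g i (E_plus (eps_vec i) m (u n)))"
    by (simp add: vac_coeff_group_op)
  finally have *: "vac_coeff \<gamma> (fermion i m (u n)) = vac_coeff \<gamma> (?g i (E_plus (eps_vec i) m (u n)))" .
  show ?thesis
  proof (cases "m > 0")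
    case True
    then have "E_plus (eps_vec i) m (u n) = 0"
      using supported_E(2)[of "eps_vec i"] by (simp add: supported_def)
    then show ?thesis
      using True unfolding u * by (auto simp: contraction_def module_hom.zero[OF linear_op_group_op])
  next
    case False
    define p where "p = nat (- m)"
    have m: "m = - int p" using False by (simp add: p_def)
    define c where "c = fps_nth (fps_exp 1 oo pair_exponent (of_bool (i = j))) p"
    have "E_plus (eps_vec i) m (u n) = c \<cdot> u (n - int p)"
      unfolding m c_def by (rule E_plus_eigen) (rule heis_u)
    then have "vac_coeff \<gamma> (fermion i m (u n)) = c * vac_coeff \<gamma> (?g i (u (n - int p)))"
      by (simp add: * module_hom.scale[OF linear_op_group_op] vac_coeff_scale)
    also have "vac_coeff \<gamma> (?g i (u (n - int p))) = of_bool (m + n = 0) * vac_coeff \<gamma> (?g i (?g j (vacuum \<beta>)))"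
      by (simp add: vac_coeff_group_op vac_u m)
    finally have **: "vac_coeff \<gamma> (fermion i m (u n)) = c * of_bool (m + n = 0) * vac_coeff \<gamma> (?g i (?g j (vacuum \<beta>)))"
      by simp
    show ?thesis
    proof (cases "i = j")
      case True
      have "c * of_bool (m + n = 0) = contraction i j m n"
        using True by (auto simp: c_def exp_pair_exponent_1 contraction_def m)
      then show ?thesis
        using ** True by (simp add: u group_op_eps_square vac_coeff_vacuum)
    next
      case False
      then have "c * of_bool (m + n = 0) = of_bool (m = 0 \<and> n = 0)"
        by (auto simp: c_def exp_pair_exponent_0 m)
      then show ?thesis
        using ** False by (simp add: u)
    qed
  qed
qed

text \<open>
  This is \<open>f(x) + f(1/x) = 2 \<delta>(-x)\<close> for \<open>f(x) = (1 - x) / (1 + x)\<close> and \<open>x = w/z\<close>, both terms being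
  expanded in nonnegative powers of their argument.
\<close>

lemma contraction_symm:
  "contraction i j m n + contraction j i n m = 2 * of_bool (i = j \<and> m + n = 0) * (- 1) powi n"
proof (cases "i = j \<and> m + n = 0")
  case True
  then have m: "m = - n" by simp
  have "(- 1 :: complex) powi (- n) = (- 1) powi n"
    by (simp add: power_int_minus_one_minus)
  then show ?thesis
    using True unfolding m by (simp add: contraction_def algebra_simps sgn_minus)
qed (auto simp: contraction_def)

lemma powi_minus_one_odd: "odd r \<Longrightarrow> (- 1 :: complex) powi (n - r) = - ((- 1) powi n)"
  by (auto simp: power_int_minus_left)

lemma osc_fermion_pair:
  assumes "odd r"
  shows "osc k r (fermion i m (fermion j n v)) = fermion i m (fermion j n (osc k r v)) +
    (of_bool (k = i) \<cdot> fermion i (m - r) (fermion j n v) + of_bool (k = j) \<cdot> fermion i m (fermion j (n - r) v))"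
  by (simp add: osc_fermion[OF assms] linear_series_add[OF linear_series_fermion] linear_series_scale[OF linear_series_fermion] algebra_simps
      del: of_bool_eq_iff)

lemma linear_op_fermion: "linear_op (fermion i m)"
  using linear_series_fermion[of i] by (simp add: linear_series_def)

text \<open>
  Both sides have the same commutators with the Heisenberg algebra: for the right hand side these
  vanish, and for the left hand side the shifted relations enter with opposite signs, as the modes of
  the oscillators are odd. The vacuum matrix elements agree by \<open>contraction_symm\<close> if \<open>i = j\<close>, and by the
  anticommutation of the group elements if \<open>i \<noteq> j\<close>.
\<close>

lemma fermion_anticommute:
  "fermion i m (fermion j n v) + fermion j n (fermion i m v) =
     (2 * of_bool (i = j \<and> m + n = 0) * (- 1) powi n) \<cdot> v"
proof -
  define s :: "int \<Rightarrow> int \<Rightarrow> complex" where "s = (\<lambda>m n. 2 * of_bool (i = j \<and> m + n = 0) * (- 1) powi n)"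
  define T where "T = (\<lambda>(m, n) v. fermion i m (fermion j n v) + fermion j n (fermion i m v) - s m n \<cdot> v)"
  have "T (m, n) v = 0"
  proof (rule heis_closed_family_eq_zero[where T = T])
    show "linear_op (T p)" for p
      unfolding T_def
      by (cases p, simp, intro linear_op_diff linear_op_add linear_op_scale linear_op_id
          linear_op_comp[OF linear_op_fermion linear_op_fermion])
    show "osc k r (T p v) - T p (osc k r v) \<in> fock.span (range (\<lambda>t. T t v))" if r: "odd r" for k r p v
    proof -
      obtain m n where p: "p = (m, n)" by (cases p)
      have "of_bool (k = i) * s (m - r) n + of_bool (k = j) * s m (n - r) = 0"
        using r by (auto simp: s_def powi_minus_one_odd)
      then have "of_bool (k = i) \<cdot> s (m - r) n \<cdot> v + of_bool (k = j) \<cdot> s m (n - r) \<cdot> v = 0"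
        by (simp flip: fock.scale_left_distrib del: of_bool_eq_iff)
      then have "osc k r (T p v) - T p (osc k r v) =
          of_bool (k = i) \<cdot> T (m - r, n) v + of_bool (k = j) \<cdot> T (m, n - r) v"
        unfolding p T_def
        by (simp add: module_hom.diff[OF linear_op_osc] module_hom.add[OF linear_op_osc] module_hom.scale[OF linear_op_osc]
            osc_fermion_pair[OF r] fock.scale_right_diff_distrib fock.scale_right_distrib algebra_simps
            del: of_bool_eq_iff fock.scale_scale)
      also have "\<dots> \<in> fock.span (range (\<lambda>t. T t v))"
        by (intro fock.span_add fock.span_scale fock.span_base rangeI)
      finally show ?thesis .
    qed
    show "vac_coeff \<gamma> (T p (vacuum \<beta>)) = 0" for p \<beta> \<gamma>
    proof (cases p)
      case (Pair m n)
      show ?thesis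
      proof (cases "i = j")
        case True
        have "vac_coeff \<gamma> (T p (vacuum \<beta>)) = (contraction i j m n + contraction j i n m - s m n) * of_bool (\<gamma> = \<beta>)"
          using True by (simp add: T_def Pair vac_coeff_diff vac_coeff_add vac_coeff_scale vac_coeff_vacuum
              vac_coeff_fermion_pair algebra_simps)
        then show ?thesis by (simp add: contraction_symm s_def)
      next
        case False
        then have "vac_coeff \<gamma> (T p (vacuum \<beta>)) = of_bool (m = 0 \<and> n = 0) * vac_coeff \<gamma>
            (group_op (mod2 (eps_vec i)) (group_op (mod2 (eps_vec j)) (vacuum \<beta>)) +
             group_op (mod2 (eps_vec j)) (group_op (mod2 (eps_vec i)) (vacuum \<beta>)))"
          by (cases "m = 0 \<and> n = 0")
             (auto simp: T_def Pair vac_coeff_diff vac_coeff_add vac_coeff_scale s_def vac_coeff_fermion_pair)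
        then show ?thesis
          by (simp add: group_op_eps_anticommute[OF False])
      qed
    qed
  qed
  then show ?thesis by (simp add: T_def s_def)
qed

section \<open>Normally ordered bilinears\<close>

text \<open>
  The normally ordered product \<open>:\<psi>\<^sub>i(m) \<psi>\<^sub>j(n):\<close> with respect to the vacuum.
\<close>

definition normal_pair :: "'n::{finite,linorder} \<Rightarrow> 'n \<Rightarrow> int \<Rightarrow> int \<Rightarrow> 'n fock \<Rightarrow> 'n fock" where
  "normal_pair i j m n v = fermion i m (fermion j n v) - contraction i j m n \<cdot> v"

text \<open>
  The Clifford scalar is the sum of the contractions in the two orders.
\<close>

lemma normal_pair_antisymm: "normal_pair i j m n v = - normal_pair j i n m v"
proof -
  have "normal_pair i j m n v + normal_pair j i n m v =
      (2 * of_bool (i = j \<and> m + n = 0) * (- 1) powi n) \<cdot> v - (contraction i j m n + contraction j i n m) \<cdot> v"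
    by (simp only: normal_pair_def fermion_anticommute[symmetric] fock.scale_left_distrib) (simp add: algebra_simps)
  then show ?thesis
    by (simp add: contraction_symm eq_neg_iff_add_eq_0)
qed

lemma linear_op_normal_pair: "linear_op (normal_pair i j m n)"
  unfolding normal_pair_def
  by (intro linear_op_diff linear_op_scale linear_op_id linear_op_comp[OF linear_op_fermion linear_op_fermion])

text \<open>
  For very negative \<open>n\<close> the mode \<open>\<psi>\<^sub>j(n)\<close> kills \<open>v\<close>. For very large \<open>n\<close> the other mode does, after
  exchanging the two by antisymmetry. In both ranges the contraction vanishes.
\<close>

lemma finite_normal_pair: "finite {n. normal_pair i j (N - n) n v \<noteq> 0}"
proof -
  obtain K where K: "\<And>n. n < K \<Longrightarrow> fermion j n v = 0"
    using lower_truncated_fermion unfolding lower_truncated_def by blast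
  obtain L where L: "\<And>n. n < L \<Longrightarrow> fermion i n v = 0"
    using lower_truncated_fermion unfolding lower_truncated_def by blast
  have "normal_pair i j (N - n) n v = 0" if "n < min K 0" for n
    using that K by (simp add: normal_pair_def contraction_def linear_series_zero[OF linear_series_fermion])
  moreover have "normal_pair i j (N - n) n v = 0" if "n > max (N - L) (max N 0)" for n
    using that L by (subst normal_pair_antisymm)
      (simp add: normal_pair_def contraction_def linear_series_zero[OF linear_series_fermion])
  ultimately have "{n. normal_pair i j (N - n) n v \<noteq> 0} \<subseteq> {min K 0..max (N - L) (max N 0)}"
    by (auto simp: not_less[symmetric])
  then show ?thesis
    by (rule finite_subset) simp
qed

text \<open>
  The coefficient of \<open>z\<^sup>N\<close> in \<open>:\<psi>\<^sub>i(z) \<psi>\<^sub>j(-az):\<close>.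
\<close>

definition bilinear :: "'n::{finite,linorder} \<Rightarrow> 'n \<Rightarrow> complex \<Rightarrow> 'n op_series" where
  "bilinear i j a N v = Sum_any (\<lambda>n. (- a) powi n \<cdot> normal_pair i j (N - n) n v)"

lemma finite_bilinear: "finite {n. c n \<cdot> normal_pair i j (N - n) n v \<noteq> 0}"
  by (rule finite_subset[OF _ finite_normal_pair[of i j N v]]) auto

lemma linear_op_bilinear: "linear_op (bilinear i j a N)"
  unfolding bilinear_def[abs_def]
  by (rule linear_op_sum_any_family[OF linear_op_scale[OF linear_op_normal_pair] finite_bilinear])

text \<open>
  The scalar that remains when a shift or a commutator disturbs the normal ordering. The summand
  vanishes unless \<open>n\<close> lies between 0 and \<open>r\<close>.
\<close>

definition sign_sum :: "complex \<Rightarrow> int \<Rightarrow> complex" where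
  "sign_sum a r = Sum_any (\<lambda>n. a powi n * of_int (sgn n - sgn (n - r)))"

lemma finite_sign_sum: "finite {n. a powi n * of_int (sgn n - sgn (n - r)) \<noteq> (0 :: complex)}"
proof -
  have "sgn n - sgn (n - r) = 0" if "\<bar>n\<bar> > \<bar>r\<bar>" for n
    using that by (auto simp: sgn_if)
  then have "{n. a powi n * of_int (sgn n - sgn (n - r)) \<noteq> (0 :: complex)} \<subseteq> {- \<bar>r\<bar>..\<bar>r\<bar>}"
    by (force simp: not_less)
  then show ?thesis
    by (rule finite_subset) simp
qed

lemma sign_sum_step:
  assumes "a \<noteq> 0"
  shows "sign_sum a (r + 1) = sign_sum a r + a powi r * (1 + a)"
proof -
  have "sign_sum a (r + 1) = Sum_any (\<lambda>n. a powi n * of_int (sgn n - sgn (n - r)) +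
      ((if n = r then a powi n else 0) + (if n = r + 1 then a powi n else 0)))"
    unfolding sign_sum_def by (rule Sum_any.cong) (auto simp: sgn_if algebra_simps)
  also have "\<dots> = sign_sum a r + (a powi r + a powi (r + 1))"
    unfolding sign_sum_def
    by (subst Sum_any.distrib[OF finite_sign_sum], rule finite_support_add)
       (simp_all add: Sum_any.distrib)
  finally show ?thesis
    using assms by (simp add: power_int_add algebra_simps)
qed

text \<open>
  Passing from \<open>r\<close> to \<open>r + 1\<close> adds \<open>a\<^sup>r + a\<^bsup>r+1\<^esup>\<close>, since only the terms \<open>n = r\<close> and \<open>n = r + 1\<close> change; the
  right hand side has the same increments.
\<close>

lemma sign_sum_eq:
  assumes "a \<noteq> 0"
  shows "sign_sum a r = (if a = 1 then 2 * of_int r else (1 + a) / (1 - a) * (1 - a powi r))"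
proof -
  define g where "g = (\<lambda>r. if a = 1 then 2 * of_int r else (1 + a) / (1 - a) * (1 - a powi r))"
  have g: "g (r + 1) = g r + a powi r * (1 + a)" for r
    using assms by (auto simp: g_def power_int_add divide_simps) algebra
  have "sign_sum a r = g r"
  proof (induction r rule: int_induct[where k = 0])
    case base
    show ?case by (simp add: sign_sum_def g_def)
  next
    case (step1 r)
    then show ?case by (simp add: sign_sum_step[OF assms] g)
  next
    case (step2 r)
    then show ?case using sign_sum_step[OF assms, of "r - 1"] g[of "r - 1"] by simp
  qed
  then show ?thesis by (simp add: g_def)
qed

text \<open>
  The commutator acts on either fermion by a shift, and the shifted products are not yet normally ordered.
  This produces the scalar term.
\<close>

lemma osc_normal_pair:
  assumes "odd r"
  shows "osc k r (normal_pair i j m n v) = normal_pair i j m n (osc k r v) +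
    (of_bool (k = i) \<cdot> normal_pair i j (m - r) n v + of_bool (k = j) \<cdot> normal_pair i j m (n - r) v) +
    (of_bool (k = i) * contraction i j (m - r) n + of_bool (k = j) * contraction i j m (n - r)) \<cdot> v"
  unfolding normal_pair_def module_hom.diff[OF linear_op_osc] osc_fermion_pair[OF assms]
    module_hom.scale[OF linear_op_osc]
  by (simp add: fock.scale_right_diff_distrib fock.scale_left_distrib algebra_simps del: of_bool_eq_iff)

lemma scale_sum_any:
  assumes "finite {p. f p \<noteq> 0}"
  shows "Sum_any (\<lambda>p. c \<cdot> f p) = c \<cdot> Sum_any f"
  by (rule linear_op_sum_any[OF linear_op_scale[OF linear_op_id] assms, symmetric])

lemma sum_any_scale_left:
  assumes "finite {p. f p \<noteq> 0}"
  shows "Sum_any (\<lambda>p. f p \<cdot> v) = Sum_any f \<cdot> v"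
proof -
  have "{p. f p \<cdot> v \<noteq> 0} \<subseteq> {p. f p \<noteq> 0}" by auto
  then have "Sum_any (\<lambda>p. f p \<cdot> v) = (\<Sum>p\<in>{p. f p \<noteq> 0}. f p \<cdot> v)"
    by (rule Sum_any.expand_superset[OF assms])
  then show ?thesis
    by (simp add: Sum_any.expand_set fock.scale_sum_left)
qed

lemma sum_any_add3:
  fixes f g h :: "'b \<Rightarrow> 'c::comm_monoid_add"
  assumes "finite {p. f p \<noteq> 0}" "finite {p. g p \<noteq> 0}" "finite {p. h p \<noteq> 0}"
  shows "Sum_any (\<lambda>p. f p + g p + h p) = Sum_any f + Sum_any g + Sum_any h"
  using Sum_any.distrib[OF finite_support_add[OF assms(1,2)] assms(3)] Sum_any.distrib[OF assms(1,2)]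
  by simp

text \<open>
  Shifting \<open>\<psi>\<^sub>j(-az)\<close> costs a factor \<open>(-a)\<^sup>r = -a\<^sup>r\<close>. For \<open>i = j\<close> the contractions left over by the two
  shifts are two different half-infinite sums, whose difference is \<open>sign_sum a r\<close>.
\<close>

lemma osc_bilinear:
  assumes a: "a \<noteq> 0" and r: "odd r"
  shows "osc k r (bilinear i j a N v) = bilinear i j a N (osc k r v) +
    (of_bool (k = i) - of_bool (k = j) * a powi r) \<cdot> bilinear i j a (N - r) v +
    (of_bool (k = i \<and> i = j \<and> N = r) * sign_sum a r) \<cdot> v"
proof -
  define c1 :: complex where "c1 = of_bool (k = i)"
  define c2 :: complex where "c2 = of_bool (k = j)"
  \<comment> \<open>the scalar contributed by the \<open>n\<close>-th normally ordered pair\<close>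
  define f where "f n = (- a) powi n * (c1 * contraction i j (N - n - r) n + c2 * contraction i j (N - n) (n - r))" for n
  have f: "f n = of_bool (k = i \<and> i = j \<and> N = r) * (a powi n * of_int (sgn n - sgn (n - r)))" for n
  proof -
    have "(- a) powi n * (- 1) powi n = a powi n"
      by (simp flip: power_int_mult_distrib)
    then show ?thesis
      using r by (auto simp: f_def c1_def c2_def contraction_def powi_minus_one_odd algebra_simps)
  qed
  have fin_f: "finite {n. f n \<noteq> 0}"
    by (rule finite_subset[OF _ finite_sign_sum[of a r]]) (auto simp: f)
  have sum_f: "Sum_any f = of_bool (k = i \<and> i = j \<and> N = r) * sign_sum a r"
    unfolding sign_sum_def by (subst Sum_any_right_distrib[OF finite_sign_sum]) (simp add: f)
  have shift: "(- a) powi n \<cdot> c2 \<cdot> normal_pair i j (N - n) (n - r) v =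
      (- (a powi r) * c2) \<cdot> ((- a) powi (n - r) \<cdot> normal_pair i j (N - r - (n - r)) (n - r) v)" for n
  proof -
    have "(- a) powi n = - (a powi r) * (- a) powi (n - r)"
      using a r by (simp add: power_int_diff power_int_minus_left)
    then show ?thesis by (simp add: mult_ac)
  qed
  have fin: "finite {n. (- a) powi n \<cdot> normal_pair i j (M - n) n v \<noteq> 0}" for M v
    by (rule finite_bilinear)
  have fin_shift: "finite {n. (- a) powi (n - r) \<cdot> normal_pair i j (N - r - (n - r)) (n - r) v \<noteq> 0}"
  proof (rule finite_subset[OF _ finite_imageI[OF fin[of "N - r" v], of "\<lambda>n. n + r"]], rule subsetI)
    fix n assume "n \<in> {n. (- a) powi (n - r) \<cdot> normal_pair i j (N - r - (n - r)) (n - r) v \<noteq> 0}"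
    then show "n \<in> (\<lambda>n. n + r) ` {n. (- a) powi n \<cdot> normal_pair i j (N - r - n) n v \<noteq> 0}"
      by (intro image_eqI[of _ _ "n - r"]) auto
  qed
  have "osc k r (bilinear i j a N v) = Sum_any (\<lambda>n. (- a) powi n \<cdot> osc k r (normal_pair i j (N - n) n v))"
    unfolding bilinear_def by (subst linear_op_sum_any[OF linear_op_osc fin]) (simp add: module_hom.scale[OF linear_op_osc])
  also have "\<dots> = Sum_any (\<lambda>n. (- a) powi n \<cdot> normal_pair i j (N - n) n (osc k r v)
      + (c1 \<cdot> ((- a) powi n \<cdot> normal_pair i j (N - r - n) n v)
         + (- (a powi r) * c2) \<cdot> ((- a) powi (n - r) \<cdot> normal_pair i j (N - r - (n - r)) (n - r) v)) + f n \<cdot> v)"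
    unfolding shift[symmetric] osc_normal_pair[OF r] f_def c1_def[symmetric] c2_def[symmetric]
    by (rule Sum_any.cong) (simp add: fock.scale_right_distrib algebra_simps)
  also have "\<dots> = bilinear i j a N (osc k r v) + (c1 \<cdot> bilinear i j a (N - r) v
      + (- (a powi r) * c2) \<cdot> bilinear i j a (N - r) v) + Sum_any f \<cdot> v"
  proof -
    have sh: "Sum_any (\<lambda>n. (- a) powi (n - r) \<cdot> normal_pair i j (N - r - (n - r)) (n - r) v) = bilinear i j a (N - r) v"
      unfolding bilinear_def by (rule sum_any_shift)
    have fins: "finite {n. c1 \<cdot> ((- a) powi n \<cdot> normal_pair i j (N - r - n) n v) \<noteq> 0}"
      "finite {n. (- (a powi r) * c2) \<cdot> ((- a) powi (n - r) \<cdot> normal_pair i j (N - r - (n - r)) (n - r) v) \<noteq> 0}"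
      "finite {n. f n \<cdot> v \<noteq> 0}"
      by (rule finite_support_linear_op[OF linear_op_scale[OF linear_op_id] fin],
          rule finite_support_linear_op[OF linear_op_scale[OF linear_op_id] fin_shift],
          rule finite_subset[OF _ fin_f], auto)
    show ?thesis
      by (simp only: sum_any_add3[OF fin finite_support_add[OF fins(1,2)] fins(3)] Sum_any.distrib[OF fins(1,2)]
          scale_sum_any[OF fin] scale_sum_any[OF fin_shift] sh sum_any_scale_left[OF fin_f] bilinear_def)
  qed
  also have "c1 \<cdot> bilinear i j a (N - r) v + (- (a powi r) * c2) \<cdot> bilinear i j a (N - r) v =
      (of_bool (k = i) - of_bool (k = j) * a powi r) \<cdot> bilinear i j a (N - r) v"
    unfolding fock.scale_left_distrib[symmetric] by (simp add: c1_def c2_def algebra_simps)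
  finally show ?thesis
    by (simp add: sum_f)
qed

section \<open>Mode expansion of the operators X\<close>

lemma supported_rescale: "supported \<sigma> A l \<Longrightarrow> supported \<sigma> (series_rescale a A) l"
  by (simp add: supported_def series_rescale_def)

lemma E_prod_properties:
  fixes i j :: "'n::finite"
  assumes a: "a \<noteq> 0"
  shows "linear_series (E_prod i j a)"
    and "heis_weight (\<lambda>k n. of_bool (k = i) - of_bool (k = j) * a powi n) (E_prod i j a)"
    and "vac_coeff \<gamma> (E_prod i j a m (vacuum \<beta>)) = of_bool (m = 0 \<and> \<gamma> = \<beta>)"
proof -
  define R where "R = E_plus (eps_vec i) \<odot> series_rescale a (E_plus (- eps_vec j))"
  define A where "A = series_rescale a (E_minus (- eps_vec j))"
  have lin_P: "linear_series (series_rescale a (E_plus (- eps_vec j)))" and lin_A: "linear_series A"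
    unfolding A_def by (intro linear_series_rescale linear_E)+
  have sum_R: "summable_product (E_plus (eps_vec i)) (series_rescale a (E_plus (- eps_vec j)))"
    by (rule summable_product_supported[OF _ linear_E(2) supported_E(2) supported_rescale[OF supported_E(2)]]) simp
  have lin_R: "linear_series R"
    unfolding R_def by (rule linear_series_mult[OF linear_E(2) lin_P sum_R])
  note weight_R = heis_weight_mult[OF linear_E(2) sum_R heis_weight_E(2) heis_weight_rescale[OF heis_weight_E(2) a linear_E(2)],
      folded R_def]
  have vac_R: "R m (vacuum \<beta>) = (if m = 0 then vacuum \<beta> else 0)" for m \<beta>
  proof -
    have "R m (vacuum \<beta>) = E_plus (eps_vec i) m (vacuum \<beta>)"
      unfolding R_def by (rule series_mult_vacuum[OF linear_E(2)]) (simp add: series_rescale_def E_plus_vacuum)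
    then show ?thesis by (simp add: E_plus_vacuum)
  qed
  have trunc_R: "lower_truncated R"
    by (rule lower_truncated_of_weight[OF lin_R weight_R]) (auto simp: vac_R intro!: exI[of _ 0])
  have supp_A: "supported 1 A 0"
    unfolding A_def by (rule supported_rescale[OF supported_E(1)])
  have sum_Q: "summable_product A R"
    by (rule summable_product_truncated[OF lin_A supp_A trunc_R])
  have lin_Q: "linear_series (A \<odot> R)"
    by (rule linear_series_mult[OF lin_A lin_R sum_Q])
  have sum_E: "summable_product (E_minus (eps_vec i)) (A \<odot> R)"
    by (rule summable_product_truncated[OF linear_E(1) supported_E(1) lower_truncated_mult[OF lin_A supp_A trunc_R]])
  have E_prod: "E_prod i j a = E_minus (eps_vec i) \<odot> (A \<odot> R)"
    by (simp add: E_prod_def A_def R_def)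
  show "linear_series (E_prod i j a)"
    unfolding E_prod by (rule linear_series_mult[OF linear_E(1) lin_Q sum_E])
  have weight_A: "heis_weight (\<lambda>k n. a powi n * (of_int (poly_mapping.lookup (- eps_vec j) k) * of_bool (0 < n))) A"
    unfolding A_def by (rule heis_weight_rescale[OF heis_weight_E(1) a linear_E(1)])
  show "heis_weight (\<lambda>k n. of_bool (k = i) - of_bool (k = j) * a powi n) (E_prod i j a)"
    unfolding E_prod
    by (rule heis_weight_cong[OF heis_weight_mult[OF linear_E(1) sum_E heis_weight_E(1)
            heis_weight_mult[OF lin_A sum_Q weight_A weight_R]]])
       (auto simp: lookup_eps_vec not_less le_less)
  have vac_A: "vac_coeff \<gamma> (A p w) = (if p = 0 then vac_coeff \<gamma> w else 0)" for p w \<gamma>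
    by (simp add: A_def series_rescale_def vac_coeff_scale vac_coeff_E_minus)
  show "vac_coeff \<gamma> (E_prod i j a m (vacuum \<beta>)) = of_bool (m = 0 \<and> \<gamma> = \<beta>)"
    unfolding E_prod vac_coeff_series_mult[OF sum_E vac_coeff_E_minus] vac_coeff_series_mult[OF sum_Q vac_A]
    by (simp add: vac_R vac_coeff_vacuum)
qed

lemma linear_op_X:
  assumes "a \<noteq> 0"
  shows "linear_op (X i j a N)"
proof -
  have E: "linear_op (E_prod i j a N)" for i j
    using E_prod_properties(1)[OF assms, of i j] by (simp add: linear_series_def)
  have diff: "(E_prod i i a - series_const 1) N = (\<lambda>v. E_prod i i a N v - (if N = 0 then v else 0))"
    by (simp add: fun_eq_iff series_const_def)
  have osc: "eps_series i N = (\<lambda>v. if odd N then osc i (- N) v else 0)"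
    by (simp add: eps_series_def)
  consider "i \<noteq> j" | "i = j" "a = 1" | "i = j" "a \<noteq> 1" by blast
  then show ?thesis
  proof cases
    case 1
    then have "X i j a N = (\<lambda>v. cocycle (eps_vec i) (eps_vec j) \<cdot> group_op (mod2 (eps_vec i - eps_vec j)) (E_prod i j a N v))"
      by (simp add: X_def)
    then show ?thesis
      by (simp only: linear_op_scale[OF linear_op_comp[OF linear_op_group_op E]])
  next
    case 2
    then have "X i j a N = (\<lambda>v. 4 \<cdot> eps_series i N v)"
      by (simp add: X_def series_smult_def)
    then show ?thesis
      unfolding osc by (simp only: linear_op_scale[OF linear_op_if[OF linear_op_osc linear_op_zero]])
  next
    case 3
    then have "X i j a N = (\<lambda>v. ((1 + a) / (1 - a)) \<cdot> (E_prod i i a - series_const 1) N v)"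
      by (simp add: X_def series_smult_def)
    then show ?thesis
      unfolding diff by (simp only: linear_op_scale[OF linear_op_diff[OF E linear_op_if[OF linear_op_id linear_op_zero]]])
  qed
qed

text \<open>
  The same formula as for \<open>bilinear i j a\<close>. For \<open>i = j\<close> the scalar arises, if \<open>a = 1\<close>, as the commutator of
  two oscillators, and otherwise from the subtraction of 1 in the definition of \<open>X\<close>.
\<close>

lemma osc_X:
  assumes a: "a \<noteq> 0" and r: "odd r"
  shows "osc k r (X i j a N v) = X i j a N (osc k r v) +
    (of_bool (k = i) - of_bool (k = j) * a powi r) \<cdot> X i j a (N - r) v +
    (of_bool (k = i \<and> i = j \<and> N = r) * sign_sum a r) \<cdot> v"
proof -
  define c where "c = of_bool (k = i) - of_bool (k = j) * a powi r"
  have E: "osc k r (E_prod i j a N v) = E_prod i j a N (osc k r v) + c \<cdot> E_prod i j a (N - r) v" for N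
    using E_prod_properties(2)[OF a, of i j] r unfolding heis_weight_def c_def
    by (metis add.commute diff_add_cancel)
  consider "i \<noteq> j" | "i = j" "a = 1" | "i = j" "a \<noteq> 1" by blast
  then show ?thesis
  proof cases
    case 1
    let ?g = "group_op (mod2 (eps_vec i - eps_vec j))"
    have "osc k r (X i j a N v) = cocycle (eps_vec i) (eps_vec j) \<cdot> ?g (osc k r (E_prod i j a N v))"
      using 1 by (simp add: X_def module_hom.scale[OF linear_op_osc] osc_group_op)
    also have "\<dots> = X i j a N (osc k r v) + c \<cdot> X i j a (N - r) v"
      using 1 by (simp add: X_def E module_hom.add[OF linear_op_group_op] module_hom.scale[OF linear_op_group_op]
          fock.scale_right_distrib mult.commute)
    finally show ?thesis
      using 1 by (simp add: c_def)
  next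
    case 2
    have X: "X i j a N w = (if odd N then 4 \<cdot> osc i (- N) w else 0)" for w
      using 2 by (simp add: X_def series_smult_def eps_series_def)
    have "osc k r (X i j a N v) - X i j a N (osc k r v) = (of_bool (k = i \<and> N = r) * (2 * of_int r)) \<cdot> v"
    proof (cases "odd N")
      case True
      then have "osc k r (X i j a N v) - X i j a N (osc k r v) =
          4 \<cdot> (osc k r (osc i (- N) v) - osc i (- N) (osc k r v))"
        by (simp add: X module_hom.scale[OF linear_op_osc] fock.scale_right_diff_distrib)
      also have "\<dots> = (of_bool (k = i \<and> N = r) * (2 * of_int r)) \<cdot> v"
        using True r by (subst osc_commutator) auto
      finally show ?thesis .
    next
      case False
      then have "N \<noteq> r" using r by auto
      then show ?thesis
        using False by (simp add: X module_hom.zero[OF linear_op_osc])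
    qed
    then have "osc k r (X i j a N v) = X i j a N (osc k r v) + (of_bool (k = i \<and> N = r) * (2 * of_int r)) \<cdot> v"
      by (simp only: diff_eq_eq add.commute)
    moreover have "of_bool (k = i \<and> N = r) * (2 * of_int r) = of_bool (k = i \<and> i = j \<and> N = r) * sign_sum a r"
      using 2 by (simp add: sign_sum_eq)
    ultimately show ?thesis
      using 2 by simp
  next
    case 3
    define d where "d = (1 + a) / (1 - a)"
    have X: "X i j a N w = d \<cdot> (E_prod i j a N w - of_bool (N = 0) \<cdot> w)" for N w
      using 3 by (simp add: X_def series_smult_def series_const_def d_def)
    have "osc k r (X i j a N v) = d \<cdot> (E_prod i j a N (osc k r v) + c \<cdot> E_prod i j a (N - r) v - of_bool (N = 0) \<cdot> osc k r v)"
      by (simp only: X module_hom.scale[OF linear_op_osc] module_hom.diff[OF linear_op_osc] E)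
    also have "\<dots> = X i j a N (osc k r v) + c \<cdot> X i j a (N - r) v + (d * c * of_bool (N = r)) \<cdot> v"
      by (auto simp: X fock.scale_right_diff_distrib fock.scale_right_distrib algebra_simps)
    also have "d * c * of_bool (N = r) = of_bool (k = i \<and> i = j \<and> N = r) * sign_sum a r"
      using 3 by (simp add: c_def sign_sum_eq[OF a] d_def)
    finally show ?thesis by (simp only: c_def)
  qed
qed

text \<open>
  The constants in the definition of \<open>X\<^sub>i\<^sub>i\<close> are such that its vacuum expectation is 0, as for a normally
  ordered product.
\<close>

lemma vac_coeff_X:
  assumes a: "a \<noteq> 0"
  shows "vac_coeff \<gamma> (X i j a N (vacuum \<beta>)) = (if i = j then 0 else of_bool (N = 0) *
    vac_coeff \<gamma> (group_op (mod2 (eps_vec i)) (group_op (mod2 (eps_vec j)) (vacuum \<beta>))))"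
proof -
  have osc: "vac_coeff \<gamma> (osc k n (vacuum \<beta>)) = 0" if "odd n" for k n
  proof (cases "n > 0")
    case False
    then have "n < 0" using that by (metis even_zero linorder_neqE_linordered_idom)
    then show ?thesis by (rule vac_coeff_osc_creation)
  qed (simp add: osc_vacuum)
  show ?thesis
    by (auto simp: X_def vac_coeff_scale vac_coeff_group_op E_prod_properties(3)[OF a] group_op_eps_eps vac_coeff_vacuum
        series_smult_def series_const_def eps_series_def osc vac_coeff_diff)
qed

lemma vac_coeff_bilinear:
  "vac_coeff \<gamma> (bilinear i j a N (vacuum \<beta>)) = (if i = j then 0 else of_bool (N = 0) *
    vac_coeff \<gamma> (group_op (mod2 (eps_vec i)) (group_op (mod2 (eps_vec j)) (vacuum \<beta>))))"
proof -
  let ?w = "vac_coeff \<gamma> (group_op (mod2 (eps_vec i)) (group_op (mod2 (eps_vec j)) (vacuum \<beta>)))"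
  have "vac_coeff \<gamma> (bilinear i j a N (vacuum \<beta>)) =
      Sum_any (\<lambda>n. (- a) powi n * vac_coeff \<gamma> (normal_pair i j (N - n) n (vacuum \<beta>)))"
    unfolding bilinear_def by (subst vac_coeff_sum_any[OF finite_bilinear]) (simp add: vac_coeff_scale)
  also have "\<dots> = Sum_any (\<lambda>n::int. if n = 0 then (if i = j then 0 else of_bool (N = 0) * ?w) else 0)"
    by (rule Sum_any.cong)
       (auto simp: normal_pair_def vac_coeff_diff vac_coeff_fermion_pair vac_coeff_scale vac_coeff_vacuum contraction_def)
  finally show ?thesis by simp
qed

text \<open>
  Equal commutators with the Heisenberg algebra (\<open>osc_X\<close>, \<open>osc_bilinear\<close>) and equal vacuum matrix
  elements: in the difference of the two sides the scalar terms cancel, so the uniqueness principle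
  applies to it.
\<close>

lemma X_eq_bilinear:
  assumes a: "a \<noteq> 0"
  shows "X i j a N v = bilinear i j a N v"
proof -
  define T where "T = (\<lambda>N v. X i j a N v - bilinear i j a N v)"
  have "T N v = 0"
  proof (rule heis_closed_family_eq_zero[where T = T])
    show "linear_op (T N)" for N
      unfolding T_def by (rule linear_op_diff[OF linear_op_X[OF a] linear_op_bilinear])
    show "osc k r (T N v) - T N (osc k r v) \<in> fock.span (range (\<lambda>t. T t v))" if r: "odd r" for k r N v
    proof -
      have "osc k r (T N v) - T N (osc k r v) = (of_bool (k = i) - of_bool (k = j) * a powi r) \<cdot> T (N - r) v"
        unfolding T_def module_hom.diff[OF linear_op_osc] osc_X[OF a r] osc_bilinear[OF a r] fock.scale_right_diff_distrib
        by simp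
      also have "\<dots> \<in> fock.span (range (\<lambda>t. T t v))"
        by (intro fock.span_scale fock.span_base rangeI)
      finally show ?thesis .
    qed
    show "vac_coeff \<gamma> (T N (vacuum \<beta>)) = 0" for N \<beta> \<gamma>
      by (simp add: T_def vac_coeff_diff vac_coeff_X[OF a] vac_coeff_bilinear)
  qed
  then show ?thesis by (simp add: T_def)
qed

section \<open>The bracket of two bilinears\<close>

text \<open>
  \<open>[xy, z] = x {y, z} - {x, z} y\<close>, and a scalar commutes with \<open>z\<close>.
\<close>

lemma normal_pair_fermion_commutator:
  "normal_pair i j m n (fermion k r v) - fermion k r (normal_pair i j m n v) =
     (2 * of_bool (j = k \<and> n + r = 0) * (- 1) powi r) \<cdot> fermion i m v
     - (2 * of_bool (i = k \<and> m + r = 0) * (- 1) powi r) \<cdot> fermion j n v"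
proof -
  have jk: "fermion j n (fermion k r v) = (2 * of_bool (j = k \<and> n + r = 0) * (- 1) powi r) \<cdot> v - fermion k r (fermion j n v)"
    by (simp only: fermion_anticommute[of j n k r v, symmetric]) simp
  have ki: "fermion k r (fermion i m w) = (2 * of_bool (i = k \<and> m + r = 0) * (- 1) powi r) \<cdot> w - fermion i m (fermion k r w)" for w
    by (simp only: fermion_anticommute[of i m k r w, symmetric]) simp
  show ?thesis
    unfolding normal_pair_def
    by (simp only: module_hom.diff[OF linear_op_fermion] module_hom.scale[OF linear_op_fermion] jk ki) simp
qed

text \<open>
  In terms of fields: \<open>[X\<^sub>i\<^sub>j(a,z), \<psi>\<^sub>k(w)] = 2 \<delta>\<^sub>j\<^sub>k \<psi>\<^sub>i(z) \<delta>(w/(az)) - 2 \<delta>\<^sub>i\<^sub>k \<psi>\<^sub>j(-az) \<delta>(-w/z)\<close>. For a given mode of \<open>\<psi>\<^sub>k\<close>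
  only one summand of the bilinear contributes to each of the two terms.
\<close>

lemma bilinear_fermion_commutator:
  assumes a: "a \<noteq> 0"
  shows "bilinear i j a M (fermion k r v) - fermion k r (bilinear i j a M v) =
    (2 * of_bool (j = k) * a powi (- r)) \<cdot> fermion i (M + r) v
    - (2 * of_bool (i = k) * ((- 1) powi M * a powi (M + r))) \<cdot> fermion j (M + r) v"
proof -
  have sgn: "(- a) powi (- r) * (- 1) powi r = a powi (- r)"
    "(- a) powi (M + r) * (- 1) powi r = (- 1) powi M * a powi (M + r)"
  proof -
    have neg: "(- a) powi n = (- 1) powi n * a powi n" for n
      by (simp flip: power_int_mult_distrib)
    have sq: "(- 1 :: complex) powi n * (- 1) powi n = 1" for n
      by (simp flip: power_int_mult_distrib)
    have "(- 1 :: complex) powi (- r) = (- 1) powi r"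
      by (rule power_int_minus_one_minus)
    then show "(- a) powi (- r) * (- 1) powi r = a powi (- r)"
      using sq[of r] by (simp only: neg) (simp add: mult_ac)
    show "(- a) powi (M + r) * (- 1) powi r = (- 1) powi M * a powi (M + r)"
      using sq[of r] by (simp only: neg) (simp add: power_int_add mult_ac)
  qed
  have lin: "linear_op (\<lambda>v. (- 1) \<cdot> fermion k r v)"
    by (rule linear_op_scale[OF linear_op_fermion])
  have "bilinear i j a M (fermion k r v) - fermion k r (bilinear i j a M v) =
      Sum_any (\<lambda>n. (- a) powi n \<cdot> normal_pair i j (M - n) n (fermion k r v)
        + (- 1) \<cdot> fermion k r ((- a) powi n \<cdot> normal_pair i j (M - n) n v))"
    unfolding bilinear_def
    by (simp only: Sum_any.distrib[OF finite_bilinear finite_support_linear_op[OF lin finite_bilinear]]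
        linear_op_sum_any[OF lin finite_bilinear, symmetric]) simp
  also have "\<dots> = Sum_any (\<lambda>n.
      (if n = - r then (2 * of_bool (j = k) * a powi (- r)) \<cdot> fermion i (M + r) v else 0)
      + (if n = M + r then - ((2 * of_bool (i = k) * ((- 1) powi M * a powi (M + r))) \<cdot> fermion j (M + r) v) else 0))"
  proof (rule Sum_any.cong)
    fix n
    have "(- a) powi n \<cdot> normal_pair i j (M - n) n (fermion k r v)
          + (- 1) \<cdot> fermion k r ((- a) powi n \<cdot> normal_pair i j (M - n) n v) =
        (- a) powi n \<cdot> (normal_pair i j (M - n) n (fermion k r v) - fermion k r (normal_pair i j (M - n) n v))"
      by (simp add: module_hom.scale[OF linear_op_fermion] fock.scale_right_diff_distrib)
    also have "\<dots> = ((- a) powi n * (- 1) powi r * (2 * of_bool (j = k \<and> n + r = 0))) \<cdot> fermion i (M - n) v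
        - ((- a) powi n * (- 1) powi r * (2 * of_bool (i = k \<and> M - n + r = 0))) \<cdot> fermion j n v"
      unfolding normal_pair_fermion_commutator fock.scale_right_diff_distrib fock.scale_scale by (simp only: mult_ac)
    also have "((- a) powi n * (- 1) powi r * (2 * of_bool (j = k \<and> n + r = 0))) \<cdot> fermion i (M - n) v =
        (if n = - r then (2 * of_bool (j = k) * a powi (- r)) \<cdot> fermion i (M + r) v else 0)"
    proof (cases "n = - r")
      case True
      then show ?thesis using sgn(1) by (simp add: mult_ac)
    qed auto
    also have "((- a) powi n * (- 1) powi r * (2 * of_bool (i = k \<and> M - n + r = 0))) \<cdot> fermion j n v =
        (if n = M + r then (2 * of_bool (i = k) * ((- 1) powi M * a powi (M + r))) \<cdot> fermion j (M + r) v else 0)"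
    proof (cases "n = M + r")
      case True
      then show ?thesis using sgn(2) by (simp add: mult_ac)
    qed auto
    finally show "(- a) powi n \<cdot> normal_pair i j (M - n) n (fermion k r v)
          + (- 1) \<cdot> fermion k r ((- a) powi n \<cdot> normal_pair i j (M - n) n v) =
        (if n = - r then (2 * of_bool (j = k) * a powi (- r)) \<cdot> fermion i (M + r) v else 0)
        + (if n = M + r then - ((2 * of_bool (i = k) * ((- 1) powi M * a powi (M + r))) \<cdot> fermion j (M + r) v) else 0)"
      by simp
  qed
  also have "\<dots> = (2 * of_bool (j = k) * a powi (- r)) \<cdot> fermion i (M + r) v
      - (2 * of_bool (i = k) * ((- 1) powi M * a powi (M + r))) \<cdot> fermion j (M + r) v"
    by (subst Sum_any.distrib) (simp_all only: Sum_any.delta, auto)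
  finally show ?thesis .
qed

lemma sum_any_reflect: "Sum_any (\<lambda>n::int. f (c - n)) = Sum_any f"
proof (rule Sum_any.reindex_cong)
  show "bij (\<lambda>n. c - n)"
    by (rule bij_betw_byWitness[where f' = "\<lambda>n. c - n"]) auto
qed (simp add: fun_eq_iff)

lemma sum_any_translate: "Sum_any (\<lambda>n::int. f (c + n)) = Sum_any f"
  using sum_any_shift[of f "- c"] by (simp add: add.commute)

lemma finite_reflect:
  assumes "finite {n::int. f n \<noteq> 0}"
  shows "finite {n. f (c - n) \<noteq> 0}" and "finite {n. f (c + n) \<noteq> 0}"
proof -
  have "{n. f (c - n) \<noteq> 0} = (\<lambda>n. c - n) ` {n. f n \<noteq> 0}"
    by (auto simp: image_iff) (metis diff_diff_eq2 add_diff_cancel_left')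
  then show "finite {n. f (c - n) \<noteq> 0}"
    using assms by simp
  have "{n. f (c + n) \<noteq> 0} = (\<lambda>n. n - c) ` {n. f n \<noteq> 0}"
    by (auto simp: image_iff) (metis add_diff_cancel_left')
  then show "finite {n. f (c + n) \<noteq> 0}"
    using assms by simp
qed

lemma scaled_bilinear:
  "finite {n. c \<cdot> (- a) powi n \<cdot> normal_pair i j (N - n) n v \<noteq> 0}"
  "Sum_any (\<lambda>n. c \<cdot> (- a) powi n \<cdot> normal_pair i j (N - n) n v) = c \<cdot> bilinear i j a N v"
  by (rule finite_support_linear_op[OF linear_op_scale[OF linear_op_id] finite_bilinear])
     (simp only: bilinear_def scale_sum_any[OF finite_bilinear])

lemma sum_any_add5:
  fixes f1 f2 f3 f4 f5 :: "'b \<Rightarrow> 'c::comm_monoid_add"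
  assumes "finite {p. f1 p \<noteq> 0}" "finite {p. f2 p \<noteq> 0}" "finite {p. f3 p \<noteq> 0}" "finite {p. f4 p \<noteq> 0}" "finite {p. f5 p \<noteq> 0}"
  shows "Sum_any (\<lambda>p. f1 p + f2 p + f3 p + f4 p + f5 p) = Sum_any f1 + Sum_any f2 + Sum_any f3 + Sum_any f4 + Sum_any f5"
  using assms by (simp add: Sum_any.distrib finite_support_add)

lemma fermion_pair_normal: "fermion i m (fermion j n v) = normal_pair i j m n v + contraction i j m n \<cdot> v"
  by (simp add: normal_pair_def)

text \<open>
  The commutator with the first bilinear is a derivation on each pair \<open>\<psi>\<^sub>k(N-n) \<psi>\<^sub>l(n)\<close> of the second,
  which gives four products of two fermions. Each is rewritten as a normally ordered pair plus a
  contraction. The four normally ordered parts sum up to bilinears after a change of the summation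
  index. The contractions cannot be summed separately, but those belonging to \<open>i = l\<close>, \<open>j = k\<close> (and
  likewise those belonging to \<open>i = k\<close>, \<open>j = l\<close>) combine for each \<open>n\<close> to a summand of \<open>sign_sum\<close>.
\<close>

lemma bilinear_commutator:
  assumes a: "a \<noteq> 0" and b: "b \<noteq> 0"
  shows "bilinear i j a M (bilinear k l b N v) - bilinear k l b N (bilinear i j a M v) =
      (2 * of_bool (j = k) * a powi (- N)) \<cdot> bilinear i l (a * b) (M + N) v
    + (- 2 * of_bool (i = l) * b powi (- M)) \<cdot> bilinear k j (a * b) (M + N) v
    + (2 * of_bool (i = k) * ((- 1) powi N * b powi (M + N))) \<cdot> bilinear l j (a / b) (M + N) v
    + (- 2 * of_bool (j = l) * (- b / a) powi N) \<cdot> bilinear i k (a / b) (M + N) v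
    + (of_bool (M + N = 0) *
        (of_bool (i = l \<and> j = k) * (2 * a powi (- N) * sign_sum (a * b) N)
         - of_bool (i = k \<and> j = l) * (2 * (- 1) powi N * sign_sum (b / a) N))) \<cdot> v"
proof -
  let ?A = "bilinear i j a M"
  note scale = module_hom.scale[OF linear_op_fermion]
  \<comment> \<open>the coefficients in the commutators of \<open>?A\<close> with \<open>\<psi>\<^sub>k(N-n)\<close> (\<open>c1\<close>, \<open>c2\<close>) and with \<open>\<psi>\<^sub>l(n)\<close> (\<open>c3\<close>, \<open>c4\<close>)\<close>
  define c1 where "c1 n = 2 * of_bool (j = k) * a powi (- (N - n))" for n
  define c2 where "c2 n = 2 * of_bool (i = k) * ((- 1) powi M * a powi (M + (N - n)))" for n
  define c3 where "c3 n = 2 * of_bool (j = l) * a powi (- n)" for n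
  define c4 where "c4 n = 2 * of_bool (i = l) * ((- 1) powi M * a powi (M + n))" for n
  \<comment> \<open>the sum of the four contractions belonging to \<open>n\<close>\<close>
  define f where "f n = (- b) powi n * (c1 n * contraction i l (M + (N - n)) n - c2 n * contraction j l (M + (N - n)) n
      + c3 n * contraction k i (N - n) (M + n) - c4 n * contraction k j (N - n) (M + n))" for n
  have comm: "?A (normal_pair k l (N - n) n v) - normal_pair k l (N - n) n (?A v) =
      c1 n \<cdot> normal_pair i l (M + (N - n)) n v + c4 n \<cdot> (- normal_pair k j (N - n) (M + n) v)
      + c2 n \<cdot> normal_pair l j n (M + (N - n)) v + c3 n \<cdot> (- normal_pair i k (M + n) (N - n) v)
      + (c1 n * contraction i l (M + (N - n)) n - c2 n * contraction j l (M + (N - n)) n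
      + c3 n * contraction k i (N - n) (M + n) - c4 n * contraction k j (N - n) (M + n)) \<cdot> v" for n
  proof -
    have kw: "?A (fermion k (N - n) w) = fermion k (N - n) (?A w) + (c1 n \<cdot> fermion i (M + (N - n)) w - c2 n \<cdot> fermion j (M + (N - n)) w)" for w
      unfolding c1_def c2_def bilinear_fermion_commutator[OF a, symmetric] by simp
    have lw: "?A (fermion l n w) = fermion l n (?A w) + (c3 n \<cdot> fermion i (M + n) w - c4 n \<cdot> fermion j (M + n) w)" for w
      unfolding c3_def c4_def bilinear_fermion_commutator[OF a, symmetric] by simp
    have "?A (normal_pair k l (N - n) n v) - normal_pair k l (N - n) n (?A v) =
        c1 n \<cdot> fermion i (M + (N - n)) (fermion l n v) - c2 n \<cdot> fermion j (M + (N - n)) (fermion l n v)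
        + c3 n \<cdot> fermion k (N - n) (fermion i (M + n) v) - c4 n \<cdot> fermion k (N - n) (fermion j (M + n) v)"
      unfolding normal_pair_def module_hom.diff[OF linear_op_bilinear] module_hom.scale[OF linear_op_bilinear] kw lw
        module_hom.add[OF linear_op_fermion] module_hom.diff[OF linear_op_fermion] scale
      by (simp add: algebra_simps)
    also have "\<dots> = c1 n \<cdot> (normal_pair i l (M + (N - n)) n v + contraction i l (M + (N - n)) n \<cdot> v)
        - c2 n \<cdot> (- normal_pair l j n (M + (N - n)) v + contraction j l (M + (N - n)) n \<cdot> v)
        + c3 n \<cdot> (- normal_pair i k (M + n) (N - n) v + contraction k i (N - n) (M + n) \<cdot> v)
        - c4 n \<cdot> (normal_pair k j (N - n) (M + n) v + contraction k j (N - n) (M + n) \<cdot> v)"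
      unfolding fermion_pair_normal normal_pair_antisymm[of j l] normal_pair_antisymm[of k i] by simp
    finally show ?thesis
      by (simp add: fock.scale_right_distrib fock.scale_left_distrib fock.scale_left_diff_distrib algebra_simps)
  qed
  \<comment> \<open>the summands of the bilinears on the right hand side; \<open>t1\<close> to \<open>t4\<close> identify the four coefficients in terms of the new summation indices \<open>n\<close>, \<open>M+N-n\<close>, \<open>N-n\<close>, \<open>M+n\<close>\<close>
  define g where "g i' j' a' n = (- a') powi n \<cdot> normal_pair i' j' (M + N - n) n v" for i' j' a' n
  have neg1: "(- c) powi n = (- 1) powi n * c powi n" for c :: complex and n
    by (simp flip: power_int_mult_distrib)
  have sq: "(- 1 :: complex) powi n * (- 1) powi n = 1" for n
    by (simp flip: power_int_mult_distrib)
  have t1: "(- b) powi n * c1 n = (2 * of_bool (j = k) * a powi (- N)) * (- (a * b)) powi n" for n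
  proof -
    have "(- (a * b)) powi n = a powi n * (- b) powi n"
      by (simp flip: power_int_mult_distrib)
    moreover have "a powi (- (N - n)) = a powi (- N) * a powi n"
      using a by (simp flip: power_int_add)
    ultimately show ?thesis by (simp add: c1_def mult_ac)
  qed
  have t4: "(- b) powi n * c4 n = (2 * of_bool (i = l) * b powi (- M)) * (- (a * b)) powi (M + n)" for n
  proof -
    have "(- (a * b)) powi (M + n) = a powi (M + n) * (- b) powi (M + n)"
      by (simp flip: power_int_mult_distrib)
    moreover have "(- b) powi (M + n) = (- 1) powi M * b powi M * (- b) powi n"
      using b by (simp add: power_int_add neg1[of b M])
    moreover have "b powi (- M) * b powi M = 1"
      using b by (simp flip: power_int_add)
    ultimately show ?thesis by (simp add: c4_def mult_ac)
  qed
  have t2: "(- b) powi n * c2 n = (2 * of_bool (i = k) * ((- 1) powi N * b powi (M + N))) * (- (a / b)) powi (M + N - n)" for n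
  proof -
    have "- (a / b) = a * inverse (- b)"
      by (simp add: divide_inverse)
    then have "(- (a / b)) powi (M + N - n) = a powi (M + N - n) * (- b) powi (- (M + N - n))"
      by (simp only: power_int_mult_distrib power_int_inverse power_int_minus)
    moreover have "b powi (M + N) = (- 1) powi (M + N) * (- b) powi (M + N)"
      by (simp flip: power_int_mult_distrib)
    moreover have "(- b) powi (M + N) * (- b) powi (- (M + N - n)) = (- b) powi n"
      using b by (simp flip: power_int_add)
    moreover have "(- 1 :: complex) powi N * (- 1) powi (M + N) = (- 1) powi M"
      using sq[of N] by (simp add: power_int_add mult_ac)
    ultimately have "(- 1) powi N * b powi (M + N) * (- (a / b)) powi (M + N - n) =
        (- 1) powi M * (a powi (M + N - n) * (- b) powi n)"
      by (simp only: mult_ac) (metis (no_types, lifting) mult.assoc mult.left_commute)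
    then show ?thesis
      by (simp only: c2_def mult.assoc add_diff_eq[symmetric]) (simp add: mult_ac add_diff_eq)
  qed
  have t3: "(- b) powi n * c3 n = (2 * of_bool (j = l) * (- b / a) powi N) * (- (a / b)) powi (N - n)" for n
  proof -
    have "- (a / b) = inverse (- b / a)"
      by simp
    then have "(- (a / b)) powi (N - n) = (- b / a) powi (- (N - n))"
      by (simp only: power_int_inverse power_int_minus)
    then have "(- b / a) powi N * (- (a / b)) powi (N - n) = (- b / a) powi n"
      using a b by (simp flip: power_int_add)
    also have "\<dots> = (- b) powi n * a powi (- n)"
      unfolding power_int_divide_distrib power_int_minus by (rule divide_inverse)
    finally show ?thesis by (simp add: c3_def mult_ac)
  qed
  define d1 where "d1 = 2 * of_bool (j = k) * a powi (- N)"
  define d2 where "d2 = 2 * of_bool (i = k) * ((- 1) powi N * b powi (M + N))"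
  define d3 where "d3 = 2 * of_bool (j = l) * (- b / a) powi N"
  define d4 where "d4 = 2 * of_bool (i = l) * b powi (- M)"
  note t = t1[folded d1_def] t2[folded d2_def] t3[folded d3_def] t4[folded d4_def]
  have f: "f n = of_bool (M + N = 0) *
      (of_bool (i = l \<and> j = k) * (2 * a powi (- N)) * ((a * b) powi n * of_int (sgn n - sgn (n - N)))
       - of_bool (i = k \<and> j = l) * (2 * (- 1) powi N) * ((b / a) powi n * of_int (sgn n - sgn (n - N))))" for n
  proof (cases "M + N = 0")
    case False
    then show ?thesis by (simp add: f_def contraction_def)
  next
    case True
    then have M: "M = - N" by simp
    have pq: "(- c) powi n * ((- 1) powi n * x) = c powi n * x" for c x :: complex and n
    proof -
      have "(- c) powi n * (- 1) powi n = c powi n"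
        by (simp flip: power_int_mult_distrib)
      then show ?thesis by (simp flip: mult.assoc)
    qed
    have e4: "b powi N * ((a * b) powi (n - N) * x) = a powi (- N) * ((a * b) powi n * x)" for x
      using a b by (simp add: power_int_diff power_int_mult_distrib power_int_minus field_simps)
    have inv: "- (a / b) = inverse (- (b / a))"
      by simp
    have e2: "(- (a / b)) powi (- n) = (- (b / a)) powi n" "(- (a / b)) powi (N - n) = (- (b / a)) powi (n - N)"
      unfolding inv power_int_inverse by (simp_all flip: power_int_minus)
    have e3: "(- b / a) powi N * ((b / a) powi (n - N) * x) = (- 1) powi N * ((b / a) powi n * x)" for x
    proof -
      have "(- b / a) powi N = (- 1) powi N * (b / a) powi N"
        using neg1[of "b / a" N] by simp
      moreover have "(b / a) powi N * (b / a) powi (n - N) = (b / a) powi n"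
        using a b by (simp flip: power_int_add)
      then have "(b / a) powi N * ((b / a) powi (n - N) * x) = (b / a) powi n * x"
        by (simp flip: mult.assoc)
      ultimately show ?thesis by (simp add: mult.assoc)
    qed
    have "f n = d1 * ((- (a * b)) powi n * contraction i l (- n) n)
        - d2 * ((- (a / b)) powi (- n) * contraction j l (- n) n)
        + d3 * ((- (a / b)) powi (N - n) * contraction k i (N - n) (n - N))
        - d4 * ((- (a * b)) powi (n - N) * contraction k j (N - n) (n - N))"
      using t(1)[of n] t(2)[of n] t(3)[of n] t(4)[of n]
      by (simp add: f_def M ring_distribs flip: mult.assoc)
    also have "\<dots> = of_bool (i = l \<and> j = k) * 2 * (a powi (- N) * ((a * b) powi n * (1 + of_int (sgn n))))
        - of_bool (i = k \<and> j = l) * 2 * ((- 1) powi N * ((b / a) powi n * (1 + of_int (sgn n))))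
        + of_bool (i = k \<and> j = l) * 2 * ((- b / a) powi N * ((b / a) powi (n - N) * (1 + of_int (sgn (n - N)))))
        - of_bool (i = l \<and> j = k) * 2 * (b powi N * ((a * b) powi (n - N) * (1 + of_int (sgn (n - N)))))"
    proof -
      have con: "contraction p q (- n) n = of_bool (p = q) * ((- 1) powi n * (1 + of_int (sgn n)))"
        "contraction p q (N - n) (n - N) = of_bool (p = q) * ((- 1) powi (n - N) * (1 + of_int (sgn (n - N))))" for p q :: 'a
        by (simp_all add: contraction_def)
      have w: "(- c) powi n * (of_bool P * ((- 1) powi n * x)) = of_bool P * (c powi n * x)"
        for P n and c x :: complex
        by (cases P) (simp_all only: pq of_bool_eq mult_1 mult_zero_left mult_zero_right)
      show ?thesis
        unfolding e2 con w d1_def d2_def d3_def d4_def M of_bool_conj eq_commute[of k i] eq_commute[of k j]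
        by (simp only: minus_minus add.left_inverse power_int_0_right) (simp only: mult_ac mult_1)
    qed
    also have "\<dots> = of_bool (i = l \<and> j = k) * (2 * a powi (- N)) * ((a * b) powi n * of_int (sgn n - sgn (n - N)))
       - of_bool (i = k \<and> j = l) * (2 * (- 1) powi N) * ((b / a) powi n * of_int (sgn n - sgn (n - N)))"
      unfolding e3 e4 by (simp add: algebra_simps)
    finally show ?thesis
      using True by simp
  qed
  have fin_f: "finite {n. f n \<noteq> 0}"
  proof (rule finite_subset[OF _ finite_UnI[OF finite_sign_sum[of "a * b" N] finite_sign_sum[of "b / a" N]]])
    have "f n = 0" if "(a * b) powi n * of_int (sgn n - sgn (n - N)) = 0"
      and "(b / a) powi n * of_int (sgn n - sgn (n - N)) = 0" for n
      unfolding f that by simp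
    then show "{n. f n \<noteq> 0} \<subseteq> {n. (a * b) powi n * of_int (sgn n - sgn (n - N)) \<noteq> 0} \<union>
        {n. (b / a) powi n * of_int (sgn n - sgn (n - N)) \<noteq> 0}"
      by blast
  qed
  have fin_s: "finite {n. x * (c powi n * of_int (sgn n - sgn (n - N))) \<noteq> (0 :: complex)}" for x c
    by (rule finite_subset[OF _ finite_sign_sum[of c N]]) auto
  have sum_f: "Sum_any f = of_bool (M + N = 0) *
        (of_bool (i = l \<and> j = k) * (2 * a powi (- N) * sign_sum (a * b) N)
         - of_bool (i = k \<and> j = l) * (2 * (- 1) powi N * sign_sum (b / a) N))"
  proof -
    have "Sum_any f = Sum_any (\<lambda>n.
        (of_bool (M + N = 0) * of_bool (i = l \<and> j = k) * (2 * a powi (- N))) * ((a * b) powi n * of_int (sgn n - sgn (n - N)))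
        + (- of_bool (M + N = 0) * of_bool (i = k \<and> j = l) * (2 * (- 1) powi N)) * ((b / a) powi n * of_int (sgn n - sgn (n - N))))"
      by (rule Sum_any.cong) (simp add: f algebra_simps)
    also have "\<dots> = (of_bool (M + N = 0) * of_bool (i = l \<and> j = k) * (2 * a powi (- N))) * sign_sum (a * b) N
        + (- of_bool (M + N = 0) * of_bool (i = k \<and> j = l) * (2 * (- 1) powi N)) * sign_sum (b / a) N"
      by (simp only: Sum_any.distrib[OF fin_s fin_s] Sum_any_right_distrib[OF finite_sign_sum, symmetric] sign_sum_def)
    finally show ?thesis by (simp add: algebra_simps)
  qed
  have lin_A: "linear_op ?A" by (rule linear_op_bilinear)
  have lin_m: "linear_op (\<lambda>v :: 'a fock. (- 1) \<cdot> v)"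
    by (rule linear_op_scale[OF linear_op_id])
  have "?A (bilinear k l b N v) - bilinear k l b N (?A v) =
      Sum_any (\<lambda>n. ?A ((- b) powi n \<cdot> normal_pair k l (N - n) n v) + (- 1) \<cdot> ((- b) powi n \<cdot> normal_pair k l (N - n) n (?A v)))"
    by (simp only: Sum_any.distrib[OF finite_support_linear_op[OF lin_A finite_bilinear] finite_support_linear_op[OF lin_m finite_bilinear]]
        linear_op_sum_any[OF lin_A finite_bilinear, symmetric] linear_op_sum_any[OF lin_m finite_bilinear, symmetric]
        bilinear_def[of k l b N, symmetric]) simp
  also have "\<dots> = Sum_any (\<lambda>n. d1 \<cdot> g i l (a * b) n + (- d4) \<cdot> g k j (a * b) (M + n)
      + d2 \<cdot> g l j (a / b) (M + N - n) + (- d3) \<cdot> g i k (a / b) (N - n) + f n \<cdot> v)"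
  proof (rule Sum_any.cong)
    fix n
    have "?A ((- b) powi n \<cdot> normal_pair k l (N - n) n v) + (- 1) \<cdot> ((- b) powi n \<cdot> normal_pair k l (N - n) n (?A v)) =
        (- b) powi n \<cdot> (?A (normal_pair k l (N - n) n v) - normal_pair k l (N - n) n (?A v))"
      by (simp add: module_hom.scale[OF lin_A] fock.scale_right_diff_distrib)
    also have "\<dots> = ((- b) powi n * c1 n) \<cdot> normal_pair i l (M + (N - n)) n v
        + ((- b) powi n * c4 n) \<cdot> (- normal_pair k j (N - n) (M + n) v)
        + ((- b) powi n * c2 n) \<cdot> normal_pair l j n (M + (N - n)) v
        + ((- b) powi n * c3 n) \<cdot> (- normal_pair i k (M + n) (N - n) v) + f n \<cdot> v"
      unfolding comm f_def by (simp only: fock.scale_right_distrib fock.scale_scale)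
    also have "\<dots> = d1 \<cdot> g i l (a * b) n + (- d4) \<cdot> g k j (a * b) (M + n)
      + d2 \<cdot> g l j (a / b) (M + N - n) + (- d3) \<cdot> g i k (a / b) (N - n) + f n \<cdot> v"
      unfolding t g_def by (simp add: algebra_simps)
    finally show "?A ((- b) powi n \<cdot> normal_pair k l (N - n) n v) + (- 1) \<cdot> ((- b) powi n \<cdot> normal_pair k l (N - n) n (?A v)) =
      d1 \<cdot> g i l (a * b) n + (- d4) \<cdot> g k j (a * b) (M + n)
      + d2 \<cdot> g l j (a / b) (M + N - n) + (- d3) \<cdot> g i k (a / b) (N - n) + f n \<cdot> v" .
  qed
  also have "\<dots> = d1 \<cdot> bilinear i l (a * b) (M + N) v + (- d4) \<cdot> bilinear k j (a * b) (M + N) v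
      + d2 \<cdot> bilinear l j (a / b) (M + N) v + (- d3) \<cdot> bilinear i k (a / b) (M + N) v + Sum_any f \<cdot> v"
  proof -
    have fin_g: "finite {n. c \<cdot> g i' j' a' n \<noteq> 0}" and sum_g: "Sum_any (\<lambda>n. c \<cdot> g i' j' a' n) = c \<cdot> bilinear i' j' a' (M + N) v" for c i' j' a'
      unfolding g_def by (rule scaled_bilinear)+
    have fin_fv: "finite {n. f n \<cdot> v \<noteq> 0}"
      by (rule finite_subset[OF _ fin_f]) auto
    show ?thesis
      by (simp only: sum_any_add5[OF fin_g finite_reflect(2)[where c = M, OF fin_g] finite_reflect(1)[where c = "M + N", OF fin_g]
            finite_reflect(1)[where c = N, OF fin_g] fin_fv]
          sum_any_reflect[where f = "\<lambda>n. c \<cdot> g i' j' a' n" for c i' j' a']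
          sum_any_translate[where f = "\<lambda>n. c \<cdot> g i' j' a' n" for c i' j' a'] sum_g sum_any_scale_left[OF fin_f])
  qed
  finally show ?thesis
    unfolding sum_f by (simp add: d1_def d2_def d3_def d4_def)
qed

lemma series_times_at_ratio: "(A \<otimes> at_ratio h c) m n v = (h n * c powi n) \<cdot> A (m + n) v"
proof -
  have "(\<lambda>p. at_ratio h c p n \<cdot> A (m - p) v) = (\<lambda>p. if p = - n then (h n * c powi n) \<cdot> A (m + n) v else 0)"
    by (auto simp: at_ratio_def fun_eq_iff)
  then show ?thesis
    unfolding series_times_def by (simp only: Sum_any.delta)
qed

text \<open>
  The scalar part of the bracket at total degree 0. If \<open>c = ab \<noteq> 1\<close>, then \<open>sign_sum c N\<close> is a difference of
  two terms, one for each of the constants attached to the first two delta functions; if \<open>ab = 1\<close>, both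
  constants are 0 and \<open>sign_sum\<close> gives the derivative of the delta function. The same holds for
  \<open>c = b/a\<close> and the other two delta functions, where \<open>(1 + c) / (1 - c)\<close> changes sign under \<open>c \<mapsto> 1/c\<close>.
\<close>

lemma central_terms:
  fixes a b :: complex
  assumes a: "a \<noteq> 0" and b: "b \<noteq> 0"
  shows "of_bool (i = l \<and> j = k) * (2 * a powi (- N) * sign_sum (a * b) N)
         - of_bool (i = k \<and> j = l) * (2 * (- 1) powi N * sign_sum (b / a) N) =
    2 * of_bool (j = k) * (1 / a) powi N * const_term i l (a * b)
    - 2 * of_bool (i = l) * b powi N * const_term j k (a * b)
    + 2 * of_bool (i = k) * (- 1) powi N * const_term j l (a * inverse b)
    - 2 * of_bool (j = l) * (- b / a) powi N * const_term i k (a * inverse b)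
    + 4 * of_bool (i = l \<and> j = k \<and> a * b = 1) * (of_int N * (1 / a) powi N)
    - 4 * of_bool (i = k \<and> j = l \<and> a = b) * (of_int N * (- 1) powi N)"
proof -
  have inv_a: "a powi (- N) = (1 / a) powi N"
    by (simp add: power_int_minus divide_inverse power_int_inverse)
  have ab: "2 * (1 / a) powi N * sign_sum (a * b) N =
      (if a * b = 1 then 4 * (of_int N * (1 / a) powi N)
       else 2 * (1 / a) powi N * ((1 + a * b) / (1 - a * b)) - 2 * b powi N * ((1 + a * b) / (1 - a * b)))"
  proof (cases "a * b = 1")
    case False
    have "(1 / a) powi N * (a * b) powi N = b powi N"
      using a by (simp flip: power_int_mult_distrib)
    then have "2 * (1 / a) powi N * (c * (1 - (a * b) powi N)) = 2 * (1 / a) powi N * c - 2 * b powi N * c" for c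
      by (simp add: algebra_simps)
    moreover have "sign_sum (a * b) N = (1 + a * b) / (1 - a * b) * (1 - (a * b) powi N)"
      using False a b by (simp add: sign_sum_eq)
    ultimately show ?thesis using False by (simp only: if_False)
  qed (use a b in \<open>simp add: sign_sum_eq\<close>)
  have ba: "2 * (- 1) powi N * sign_sum (b / a) N =
      (if a = b then 4 * (of_int N * (- 1) powi N)
       else 2 * (- b / a) powi N * ((1 + a * inverse b) / (1 - a * inverse b)) - 2 * (- 1) powi N * ((1 + a * inverse b) / (1 - a * inverse b)))"
  proof (cases "a = b")
    case False
    have c: "(1 + b / a) / (1 - b / a) = - ((1 + a * inverse b) / (1 - a * inverse b))"
      using a b False by (simp add: divide_simps) (simp add: algebra_simps)
    have "(- b / a) powi N = (- 1) powi N * (b / a) powi N"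
      by (simp flip: power_int_mult_distrib)
    then have "2 * (- 1) powi N * (- c * (1 - (b / a) powi N)) = 2 * (- b / a) powi N * c - 2 * (- 1) powi N * c" for c
      by (simp add: algebra_simps)
    moreover have "b / a \<noteq> 1" using False a by simp
    ultimately show ?thesis using False a b by (simp add: sign_sum_eq c del: mult_minus_left)
  qed (use a b in \<open>simp add: sign_sum_eq\<close>)
  have one: "a * inverse b = 1 \<longleftrightarrow> a = b"
    using b by (simp add: field_simps)
  show ?thesis
    unfolding inv_a ab ba const_term_def one by (auto simp: algebra_simps)
qed

theorem theorem2p15:
  fixes i j k l :: "'n::{finite,linorder}" and a b :: complex
  assumes "card (UNIV :: 'n set) \<ge> 2" and "a \<noteq> 0" and "b \<noteq> 0"
  shows "op_bracket (X i j a) (X k l b) =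
      (2 * of_bool (j = k)) \<bullet>
        ((X i l (a * b) + series_const (const_term i l (a * b))) \<otimes> at_ratio delta (1 / a))
    - (2 * of_bool (i = l)) \<bullet>
        ((series_rescale (inverse b) (X k j (a * b)) + series_const (const_term j k (a * b)))
          \<otimes> at_ratio delta b)
    + (2 * of_bool (i = k)) \<bullet>
        ((series_rescale b (X l j (a * inverse b)) + series_const (const_term j l (a * inverse b)))
          \<otimes> at_ratio delta (- 1))
    - (2 * of_bool (j = l)) \<bullet>
        ((X i k (a * inverse b) + series_const (const_term i k (a * inverse b)))
          \<otimes> at_ratio delta (- b / a))
    + (4 * of_bool (i = l \<and> j = k \<and> a * b = 1)) \<bullet>
        (series_const 1 \<otimes> at_ratio D_delta (1 / a))
    - (4 * of_bool (i = k \<and> j = l \<and> a = b)) \<bullet>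
        (series_const 1 \<otimes> at_ratio D_delta (- 1))"
    (is "_ = ?rhs")
proof (intro ext)
  fix M N :: int and v :: "'n fock"
  note a = assms(2) and b = assms(3)
  let ?Z = "of_bool (M + N = 0) :: complex"
  have X: "X p q c P v = bilinear p q c P v" if "c \<noteq> 0" for p q c P and v :: "'n fock"
    using X_eq_bilinear[OF that] .
  have const: "series_const c (M + N) v = (?Z * c) \<cdot> v" for c
    by (simp add: series_const_def)
  have ab: "a * b \<noteq> 0" and a_b: "a * inverse b \<noteq> 0"
    using a b by simp_all
  have bN: "b powi N * inverse b powi (M + N) = b powi (- M)"
    using b by (simp add: power_int_inverse power_int_add power_int_minus field_simps)
  have rhs: "?rhs M N v =
      (2 * of_bool (j = k) * (1 / a) powi N) \<cdot> bilinear i l (a * b) (M + N) v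
    + (- 2 * of_bool (i = l) * (b powi N * inverse b powi (M + N))) \<cdot> bilinear k j (a * b) (M + N) v
    + (2 * of_bool (i = k) * ((- 1) powi N * b powi (M + N))) \<cdot> bilinear l j (a * inverse b) (M + N) v
    + (- 2 * of_bool (j = l) * (- b / a) powi N) \<cdot> bilinear i k (a * inverse b) (M + N) v
    + (?Z * (2 * of_bool (j = k) * (1 / a) powi N * const_term i l (a * b)
    - 2 * of_bool (i = l) * b powi N * const_term j k (a * b)
    + 2 * of_bool (i = k) * (- 1) powi N * const_term j l (a * inverse b)
    - 2 * of_bool (j = l) * (- b / a) powi N * const_term i k (a * inverse b)
    + 4 * of_bool (i = l \<and> j = k \<and> a * b = 1) * (of_int N * (1 / a) powi N)
    - 4 * of_bool (i = k \<and> j = l \<and> a = b) * (of_int N * (- 1) powi N))) \<cdot> v"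
    unfolding plus_fun_def fun_diff_def series2_smult_def series_times_at_ratio series_rescale_def const X[OF ab] X[OF a_b]
      delta_def D_delta_def fock.scale_right_distrib fock.scale_scale
    by (simp add: fock.scale_left_distrib fock.scale_left_diff_distrib algebra_simps
        del: of_bool_eq_iff)
  have "op_bracket (X i j a) (X k l b) M N v =
      bilinear i j a M (bilinear k l b N v) - bilinear k l b N (bilinear i j a M v)"
    by (simp add: op_bracket_def X a b)
  also have "\<dots> = ?rhs M N v"
    unfolding bilinear_commutator[OF a b] central_terms[OF a b] rhs bN
    by (simp add: power_int_minus divide_inverse power_int_inverse)
  finally show "op_bracket (X i j a) (X k l b) M N v = ?rhs M N v" .
qed

end
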